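(* Let $\sigma>0$. With $\mathfrak{B}_{\sigma^2}$, $\mathbf{U}$, $\mathbf{V}$ as defined in the context: (i) For $\mathbf{A},\mathbf{B}\in\mathcal{S}^d_{++}$, the optimal pair $(\mathbf{F}^*,\mathbf{G}^* )$ of $$\max_{\mathbf{F},\mathbf{G}\succ0}\Big\{\langle\mathrm{Id}-\mathbf{F},\mathbf{A}\rangle+\langle\mathrm{Id}-\mathbf{G},\mathbf{B}\rangle+\sigma^2\log\det\Big(\frac{\mathbf{F}\mathbf{G}-\mathrm{Id}}{\sigma^4}\Big)+\sigma^2\log\det\mathbf{A}\mathbf{B}+2d\sigma^2\Big\}$$ is a solution of the fixed point equations $\mathbf{F}=\sigma^2\mathbf{A}^{-1}+\mathbf{G}^{-1}$, $\mathbf{G}=\sigma^2\mathbf{B}^{-1}+\mathbf{F}^{-1}$. (ii) $\mathfrak{B}_{\sigma^2}$ is differentiable and $\nabla\mathfrak{B}_{\sigma^2}(\mathbf{A},\mathbf{B})=-(\sigma^2\mathbf{U},\sigma^2\mathbf{V})$. Thus $$\nabla_{\mathbf{A}}\mathfrak{B}_{\sigma^2}(\mathbf{A},\mathbf{B})=\mathrm{Id}-\mathbf{B}^{1/2}\Big(\big(\mathbf{B}^{1/2}\mathbf{A}\mathbf{B}^{1/2}+\tfrac{\sigma^4}{4}\mathrm{Id}\big)^{1/2}+\tfrac{\sigma^2}{2}\mathrm{Id}\Big)^{-1}\mathbf{B}^{1/2}.$$ (iii) $(\mathbf{A},\mathbf{B})\mapsto\mathfrak{B}_{\sigma^2}(\mathbf{A},\mathbf{B})$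 is convex in $\mathbf{A}$ and convex in $\mathbf{B}$, but not jointly convex. (iv) For fixed $\mathbf{B}$ with spectral decomposition $\mathbf{B}=\mathbf{P}\Sigma\mathbf{P}^\top$, the function $\phi_{\mathbf{B}}:\mathbf{A}\mapsto\mathfrak{B}_{\sigma^2}(\mathbf{A},\mathbf{B})$ is minimized at $\mathbf{A}_0=\mathbf{P}(\Sigma-\sigma^2\mathrm{Id})_+\mathbf{P}^\top$, where $x_+=\max(x,0)$ for $x\in\mathbb{R}$, extended element-wise to diagonal matrices.
   Context: $\mathcal{S}^d_{++}$ and $\mathcal{S}^d_+$ are the symmetric positive definite and positive semi-definite $d\times d$ real matrices; $\langle\cdot,\cdot\rangle$ is the Frobenius inner product and gradients are taken with respect to it. For $\mathbf{A},\mathbf{B}\in\mathcal{S}^d_+$, $$\mathfrak{B}_{\sigma^2}(\mathbf{A},\mathbf{B})=\mathrm{tr}(\mathbf{A})+\mathrm{tr}(\mathbf{B})-\mathrm{tr}(\mathbf{D}_\sigma)+d\sigma^2(1-\log(2\sigma^2))+\sigma^2\log\det(\mathbf{D}_\sigma+\sigma^2\mathrm{Id}),\quad \mathbf{D}_\sigma=(4\mathbf{A}^{1/2}\mathbf{B}\mathbf{A}^{1/2}+\sigma^4\mathrm{Id})^{1/2};$$ for $\mathbf{A},\mathbf{B}\in\mathcal{S}^d_{++}$ it equals the entropic optimal transport cost $\min_{\pi\in\Pi(\alpha,\beta)}\int\|x-y\|^2d\pi+2\sigma^2\mathrm{KL}(\pi\|\alpha\otimes\beta)$ between $\alpha=\mathcal{N}(0,\mathbf{A})$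 and $\beta=\mathcal{N}(0,\mathbf{B})$. At a point of $\mathcal{S}^d_+\times\mathcal{S}^d_+$ with a singular component, differentiability means that the first-order expansion with the stated gradient holds along points of $\mathcal{S}^d_+\times\mathcal{S}^d_+$. Further, $$\mathbf{U}=\tfrac{1}{\sigma^2}\mathbf{B}(\mathbf{C}+\sigma^2\mathrm{Id})^{-1}-\tfrac{1}{\sigma^2}\mathrm{Id},\qquad \mathbf{V}=\tfrac{1}{\sigma^2}(\mathbf{C}+\sigma^2\mathrm{Id})^{-1}\mathbf{A}-\tfrac{1}{\sigma^2}\mathrm{Id},\qquad \mathbf{C}=\big(\mathbf{A}\mathbf{B}+\tfrac{\sigma^4}{4}\mathrm{Id}\big)^{1/2}-\tfrac{\sigma^2}{2}\mathrm{Id},$$ where the square root of $\mathbf{A}\mathbf{B}+\frac{\sigma^4}{4}\mathrm{Id}$ is the principal one (positive eigenvalues). In the maximization problem, $\log\det\big((\mathbf{F}\mathbf{G}-\mathrm{Id})/\sigma^4\big)$ is taken to be $-\infty$ unless $\begin{pmatrix}\mathbf{F}&-\mathrm{Id}\\-\mathrm{Id}&\mathbf{G}\end{pmatrix}\succ0$ (equivalently, all eigenvalues of $\mathbf{F}\mathbf{G}$ exceed $1$). *)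

theory Defs
  imports "HOL-Analysis.Analysis"
begin

(* The inner product of real^'n^'n is the sum over all entries, i.e. the Frobenius inner product. *)

definition sym_matrices :: "(real^'n^'n) set" where
  "sym_matrices = {A. transpose A = A}"

definition psd_matrices :: "(real^'n^'n) set" where
  "psd_matrices = {A \<in> sym_matrices. \<forall>x. 0 \<le> x \<bullet> (A *v x)}"

definition pd_matrices :: "(real^'n^'n) set" where
  "pd_matrices = {A \<in> sym_matrices. \<forall>x. x \<noteq> 0 \<longrightarrow> 0 < x \<bullet> (A *v x)}"

definition diag_matrix :: "real^'n \<Rightarrow> real^'n^'n" where
  "diag_matrix s = (\<chi> i j. if i = j then s $ i else 0)"

(* Meaningful for positive semi-definite arguments, where the square root exists and is unique. *)
definition psd_sqrt :: "real^'n^'n \<Rightarrow> real^'n^'n" where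
  "psd_sqrt A = (THE S. S \<in> psd_matrices \<and> S ** S = A)"

(* All complex eigenvalues are real and positive. *)
definition positive_spectrum :: "real^'n^'n \<Rightarrow> bool" where
  "positive_spectrum R \<longleftrightarrow>
     (\<forall>(c::complex) v. v \<noteq> 0 \<and> map_matrix complex_of_real R *v v = c *s v \<longrightarrow> c \<in> \<real> \<and> 0 < Re c)"

(* Applied to matrices that need not be symmetric, but are diagonalizable with positive eigenvalues;
   such a matrix has exactly one square root with positive spectrum. *)
definition principal_sqrt :: "real^'n^'n \<Rightarrow> real^'n^'n" where
  "principal_sqrt M = (THE R. R ** R = M \<and> positive_spectrum R)"

definition D_mat :: "real \<Rightarrow> real^'n^'n \<Rightarrow> real^'n^'n \<Rightarrow> real^'n^'n" where
  "D_mat \<sigma> A B = psd_sqrt (4 *\<^sub>R (psd_sqrt A ** B ** psd_sqrt A) + \<sigma>^4 *\<^sub>R mat 1)"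

definition entropic_bures :: "real \<Rightarrow> real^'n^'n \<Rightarrow> real^'n^'n \<Rightarrow> real" where
  "entropic_bures \<sigma> A B =
     trace A + trace B - trace (D_mat \<sigma> A B)
     + real CARD('n) * \<sigma>\<^sup>2 * (1 - ln (2 * \<sigma>\<^sup>2))
     + \<sigma>\<^sup>2 * ln (det (D_mat \<sigma> A B + \<sigma>\<^sup>2 *\<^sub>R mat 1))"

definition C_mat :: "real \<Rightarrow> real^'n^'n \<Rightarrow> real^'n^'n \<Rightarrow> real^'n^'n" where
  "C_mat \<sigma> A B = principal_sqrt (A ** B + (\<sigma>^4 / 4) *\<^sub>R mat 1) - (\<sigma>\<^sup>2 / 2) *\<^sub>R mat 1"

definition U_mat :: "real \<Rightarrow> real^'n^'n \<Rightarrow> real^'n^'n \<Rightarrow> real^'n^'n" where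
  "U_mat \<sigma> A B =
     (1 / \<sigma>\<^sup>2) *\<^sub>R (B ** matrix_inv (C_mat \<sigma> A B + \<sigma>\<^sup>2 *\<^sub>R mat 1)) - (1 / \<sigma>\<^sup>2) *\<^sub>R mat 1"

definition V_mat :: "real \<Rightarrow> real^'n^'n \<Rightarrow> real^'n^'n \<Rightarrow> real^'n^'n" where
  "V_mat \<sigma> A B =
     (1 / \<sigma>\<^sup>2) *\<^sub>R (matrix_inv (C_mat \<sigma> A B + \<sigma>\<^sup>2 *\<^sub>R mat 1) ** A) - (1 / \<sigma>\<^sup>2) *\<^sub>R mat 1"

(* The 2x2 block matrix with rows (F, -Id) and (-Id, G). *)
definition block_mat :: "real^'n^'n \<Rightarrow> real^'n^'n \<Rightarrow> real^('n + 'n)^('n + 'n)" where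
  "block_mat F G = (\<chi> i j. case (i, j) of
       (Inl a, Inl b) \<Rightarrow> F $ a $ b
     | (Inl a, Inr b) \<Rightarrow> - (mat 1 $ a $ b)
     | (Inr a, Inl b) \<Rightarrow> - (mat 1 $ a $ b)
     | (Inr a, Inr b) \<Rightarrow> G $ a $ b)"

(* log det ((F G - Id) / sigma^4), with value -infinity off the domain; ln (det _) alone would not do,
   since the determinant can be positive there. *)
definition log_det_term :: "real \<Rightarrow> real^'n^'n \<Rightarrow> real^'n^'n \<Rightarrow> ereal" where
  "log_det_term \<sigma> F G =
     (if block_mat F G \<in> pd_matrices
      then ereal (ln (det ((1 / \<sigma>^4) *\<^sub>R (F ** G - mat 1)))) else - \<infinity>)"

definition dual_objective ::
  "real \<Rightarrow> real^'n^'n \<Rightarrow> real^'n^'n \<Rightarrow> real^'n^'n \<Rightarrow> real^'n^'n \<Rightarrow> ereal" where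
  "dual_objective \<sigma> A B F G =
     ereal ((mat 1 - F) \<bullet> A + (mat 1 - G) \<bullet> B)
     + ereal (\<sigma>\<^sup>2) * log_det_term \<sigma> F G
     + ereal (\<sigma>\<^sup>2 * ln (det (A ** B)) + 2 * real CARD('n) * \<sigma>\<^sup>2)"

definition is_dual_optimal ::
  "real \<Rightarrow> real^'n^'n \<Rightarrow> real^'n^'n \<Rightarrow> (real^'n^'n) \<times> (real^'n^'n) \<Rightarrow> bool" where
  "is_dual_optimal \<sigma> A B =
     is_arg_max (\<lambda>(F, G). dual_objective \<sigma> A B F G) (\<lambda>p. p \<in> pd_matrices \<times> pd_matrices)"

(* Gradient of f, defined on a subset S of a linear space E, at x in S: an element g of E giving the
   first-order expansion of f along S. For E the symmetric matrices (or pairs of them) and S the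
   positive semi-definite ones, g is unique, and at positive definite points this is the usual
   gradient in E because these are interior points of S relative to E. *)
definition has_gradient_in ::
  "'a::real_inner set \<Rightarrow> ('a \<Rightarrow> real) \<Rightarrow> 'a \<Rightarrow> 'a \<Rightarrow> 'a set \<Rightarrow> bool" where
  "has_gradient_in E f g x S \<longleftrightarrow> g \<in> E \<and> (f has_derivative (\<lambda>h. g \<bullet> h)) (at x within S)"

end

theory Submission
  imports Defs
begin

text \<open>
Write \<open>t = \<sigma>\<^sup>2\<close>, \<open>a = A\<^sup>1\<^sup>/\<^sup>2\<close>, \<open>b = B\<^sup>1\<^sup>/\<^sup>2\<close>. For a positive semidefinite \<open>M\<close> put
\<open>S(M) = (M + (t\<^sup>2/4) Id)\<^sup>1\<^sup>/\<^sup>2\<close> and \<open>K(M) = (S(M) + (t/2) Id)\<^sup>-\<^sup>1\<close>. Up to a constant the entropic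
cost is \<open>tr A + tr B + H(a B a)\<close>, where \<open>H(M) = t log det (S(M) + (t/2) Id) - 2 tr S(M)\<close>.
The function \<open>H\<close> is convex with gradient \<open>-K(M)\<close>; this is the tangent inequality
\<open>bures_spectral_tangent\<close>, which follows from the tangent inequality of \<open>log det\<close> (\<open>ln_det_le\<close>).
Since \<open>(a B a) (a b) = (a b) (b A b)\<close>, the matrices \<open>S\<close> and \<open>K\<close> of \<open>a B a\<close> and of \<open>b A b\<close> are
intertwined by \<open>a b\<close>, whence \<open>H(a B a) = H(b A b)\<close>, also for singular \<open>A\<close> and \<open>B\<close>.

Gradients and convexity. As \<open>b A b\<close> is linear in \<open>A\<close>, the tangent inequality of \<open>H\<close> turns into one
for the cost \<open>tr A + tr B + H(b A b)\<close> as a function of \<open>A\<close>, with slope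
\<open>Id - \<Phi>(A,B)\<close>, \<open>\<Phi>(A,B) = b K(b A b) b\<close> (\<open>entropic_bures_tangent\<close>). Convexity in each argument is
immediate. Writing the inequality at both ends of a segment squeezes the remainder of the
first-order expansion between \<open>0\<close> and the variation of the slope; as \<open>\<Phi>\<close> is jointly continuous on
the closed cone (the square root is Hoelder continuous there), this gives differentiability up to
the boundary, although \<open>A\<^sup>1\<^sup>/\<^sup>2\<close> itself is not differentiable there. The formulas with \<open>U\<close> and \<open>V\<close> hold
because \<open>\<Phi>(B,A) B = A \<Phi>(A,B)\<close> is the matrix \<open>C\<close>: shifted by \<open>t/2\<close> it squares to \<open>A B + (t\<^sup>2/4) Id\<close>
and it has positive spectrum, and a root of that kind is unique (\<open>principal_sqrt_product\<close>).

Minimizer. In the eigenbasis of \<open>B\<close> the slope at \<open>A\<^sub>0 = P (\<Sigma> - t Id)\<^sub>+ P\<^sup>T\<close> is diagonal with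
nonnegative entries that vanish wherever those of \<open>A\<^sub>0\<close> do not, so the tangent inequality at
\<open>A\<^sub>0\<close> bounds the cost from below by its value there.

Joint convexity fails on multiples of the identity: \<open>r \<mapsto> cost(r Id, r Id)\<close> is strictly
concave.

Dual problem. By a Schur complement the feasible set is \<open>G \<succ> 0\<close>, \<open>E = F - G\<^sup>-\<^sup>1 \<succ> 0\<close>, and
\<open>det (F G - Id) = det E det G\<close>. In the variables \<open>(E, G)\<close> the objective is concave, and it is
strictly below its value at \<open>G\<^sub>0 = \<Phi>(A,B)\<^sup>-\<^sup>1\<close>, \<open>E\<^sub>0 = t A\<^sup>-\<^sup>1\<close> everywhere else, by the strict tangent
inequality of \<open>log det\<close> and the convexity of the matrix inverse; stationarity in \<open>G\<close> is the Riccati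
equation \<open>W A W + t W = B\<close> for \<open>W = \<Phi>(A,B)\<close> (\<open>dual_problem\<close>).
\<close>

section \<open>Matrix algebra and the Frobenius inner product\<close>

lemma matrix_diff_ldistrib: "A ** (B - C) = A ** B - A ** (C :: real^'n^'m)"
  by (simp add: matrix_matrix_mult_def vec_eq_iff right_diff_distrib sum_subtractf)

lemma matrix_diff_rdistrib: "(A - B) ** C = A ** C - B ** (C :: real^'n^'m)"
  by (simp add: matrix_matrix_mult_def vec_eq_iff left_diff_distrib sum_subtractf)

lemma matrix_add_rdistrib: "(A + B) ** C = A ** C + B ** (C :: real^'n^'m)"
  by (simp add: matrix_matrix_mult_def vec_eq_iff distrib_right sum.distrib)

lemma matrix_scaleR_left: "(c *\<^sub>R A) ** B = c *\<^sub>R (A ** (B :: real^'n^'m))"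
  by (simp add: matrix_matrix_mult_def vec_eq_iff sum_distrib_left mult.assoc)

lemma matrix_scaleR_right: "A ** (c *\<^sub>R B) = c *\<^sub>R (A ** (B :: real^'n^'m))"
  by (simp add: matrix_matrix_mult_def vec_eq_iff sum_distrib_left mult.left_commute)

lemma matrix_minus_left: "(- A) ** B = - (A ** (B :: real^'n^'m))"
  by (simp add: matrix_matrix_mult_def vec_eq_iff sum_negf)

lemma matrix_minus_right: "A ** (- B) = - (A ** (B :: real^'n^'m))"
  by (simp add: matrix_matrix_mult_def vec_eq_iff sum_negf)

lemma matrix_zero_left: "0 ** (B :: real^'n^'m) = 0"
  by (simp add: matrix_matrix_mult_def vec_eq_iff)

lemma matrix_zero_right: "(B :: real^'n^'m) ** 0 = 0"
  by (simp add: matrix_matrix_mult_def vec_eq_iff)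

text \<open>The product of matrices is not the multiplication of a ring type class, so the ring laws are
  collected here for rewriting. Products are normalized to associate to the left.\<close>

lemmas mat_ring = matrix_diff_ldistrib matrix_diff_rdistrib matrix_add_ldistrib
  matrix_add_rdistrib matrix_scaleR_left matrix_scaleR_right matrix_minus_left matrix_minus_right
  matrix_zero_left matrix_zero_right matrix_mul_assoc

lemma transpose_add: "transpose (A + B) = transpose A + transpose (B :: real^'n^'m)"
  by (simp add: transpose_def vec_eq_iff)

lemma transpose_diff: "transpose (A - B) = transpose A - transpose (B :: real^'n^'m)"
  by (simp add: transpose_def vec_eq_iff)

lemma inner_matrix_sum: "(A :: real^'n^'m) \<bullet> B = (\<Sum>i\<in>UNIV. \<Sum>j\<in>UNIV. A $ i $ j * B $ i $ j)"
  by (simp add: inner_vec_def)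

lemma inner_matrix_columns: "(A :: real^'n^'m) \<bullet> B = (\<Sum>j\<in>UNIV. column j A \<bullet> column j B)"
  unfolding inner_matrix_sum by (subst sum.swap) (simp add: inner_vec_def column_def)

lemma inner_transpose: "transpose (A :: real^'n^'m) \<bullet> transpose B = A \<bullet> B"
  unfolding inner_matrix_sum by (subst sum.swap) (simp add: transpose_def)

text \<open>The adjoints of left and right multiplication for the Frobenius inner product.\<close>

lemma inner_mult_left: "((X :: real^'k^'m) ** Y) \<bullet> Z = (Y :: real^'n^'k) \<bullet> (transpose X ** Z)"
proof -
  have "(X ** Y) \<bullet> Z = (\<Sum>i\<in>UNIV. \<Sum>j\<in>UNIV. \<Sum>k\<in>UNIV. X $ i $ k * Y $ k $ j * Z $ i $ j)"
    by (simp add: inner_matrix_sum matrix_matrix_mult_def sum_distrib_right)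
  also have "\<dots> = (\<Sum>i\<in>UNIV. \<Sum>k\<in>UNIV. \<Sum>j\<in>UNIV. X $ i $ k * Y $ k $ j * Z $ i $ j)"
    by (rule sum.cong [OF refl], rule sum.swap)
  also have "\<dots> = (\<Sum>k\<in>UNIV. \<Sum>i\<in>UNIV. \<Sum>j\<in>UNIV. X $ i $ k * Y $ k $ j * Z $ i $ j)"
    by (rule sum.swap)
  also have "\<dots> = (\<Sum>k\<in>UNIV. \<Sum>j\<in>UNIV. \<Sum>i\<in>UNIV. X $ i $ k * Y $ k $ j * Z $ i $ j)"
    by (rule sum.cong [OF refl], rule sum.swap)
  also have "\<dots> = Y \<bullet> (transpose X ** Z)"
    by (simp add: inner_matrix_sum matrix_matrix_mult_def transpose_def sum_distrib_left mult_ac)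
  finally show ?thesis .
qed

lemma inner_mult_right: "((X :: real^'k^'m) ** Y) \<bullet> Z = (X :: real^'k^'m) \<bullet> (Z ** transpose (Y :: real^'n^'k))"
proof -
  have "(X ** Y) \<bullet> Z = (transpose Y ** transpose X) \<bullet> transpose Z"
    by (simp only: inner_transpose matrix_transpose_mul [symmetric])
  also have "\<dots> = transpose X \<bullet> (Y ** transpose Z)"
    by (simp add: inner_mult_left)
  also have "\<dots> = X \<bullet> (Z ** transpose Y)"
    by (subst inner_transpose [symmetric]) (simp only: matrix_transpose_mul transpose_transpose)
  finally show ?thesis .
qed

text \<open>The trace is written as an inner product with the identity throughout, so that the adjointness
  laws above apply to it.\<close>

lemma trace_inner: "trace (A :: real^'n^'n) = mat 1 \<bullet> A"
  by (simp add: trace_def inner_matrix_sum mat_def if_distrib [of "\<lambda>x. x * _"] cong: if_cong)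

lemma inner_mat_1: "(mat 1 :: real^'n^'n) \<bullet> mat 1 = real CARD('n)"
  by (simp add: trace_inner [symmetric] trace_I)

lemma det_scaleR: "det (c *\<^sub>R (A :: real^'n^'n)) = c ^ CARD('n) * det A"
proof -
  have "c *\<^sub>R A = (\<chi> i. c *s A $ i)"
    by (simp add: vec_eq_iff)
  then show ?thesis
    using det_rows_mul [of "\<lambda>_. c" "\<lambda>i. A $ i"] by simp
qed

section \<open>Positive semidefinite matrices\<close>

lemma sym_inner_mult: "A \<in> sym_matrices \<Longrightarrow> x \<bullet> (A *v y) = (A *v x) \<bullet> (y :: real^'n)"
  using transpose_matrix_vector [of A x] by (simp add: sym_matrices_def dot_lmul_matrix)

lemma sym_transpose: "A \<in> sym_matrices \<Longrightarrow> transpose A = A"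
  by (simp add: sym_matrices_def)

lemma psd_sym: "A \<in> psd_matrices \<Longrightarrow> A \<in> sym_matrices"
  by (simp add: psd_matrices_def)

lemma pd_psd: "A \<in> pd_matrices \<Longrightarrow> A \<in> psd_matrices"
  unfolding psd_matrices_def pd_matrices_def
  by (auto intro: less_imp_le) (metis inner_zero_left less_eq_real_def order_refl)

lemma pd_sym: "A \<in> pd_matrices \<Longrightarrow> A \<in> sym_matrices"
  by (simp add: pd_matrices_def)

lemma psd_quadratic: "A \<in> psd_matrices \<Longrightarrow> 0 \<le> x \<bullet> (A *v x)"
  by (simp add: psd_matrices_def)

lemma sym_mat_1: "mat 1 \<in> sym_matrices"
  by (simp add: sym_matrices_def)

lemma sym_add: "A \<in> sym_matrices \<Longrightarrow> B \<in> sym_matrices \<Longrightarrow> A + B \<in> sym_matrices"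
  by (simp add: sym_matrices_def transpose_add)

lemma sym_diff: "A \<in> sym_matrices \<Longrightarrow> B \<in> sym_matrices \<Longrightarrow> A - B \<in> sym_matrices"
  by (simp add: sym_matrices_def transpose_diff)

lemma sym_scaleR: "A \<in> sym_matrices \<Longrightarrow> c *\<^sub>R A \<in> sym_matrices"
  by (simp add: sym_matrices_def transpose_scalar)

lemma sym_conj: "M \<in> sym_matrices \<Longrightarrow> X ** M ** transpose X \<in> sym_matrices"
  by (simp add: sym_matrices_def matrix_transpose_mul matrix_mul_assoc)

lemma psd_mat_1: "mat 1 \<in> psd_matrices"
  by (simp add: psd_matrices_def sym_mat_1)

lemma pd_mat_1: "mat 1 \<in> pd_matrices"
  by (simp add: pd_matrices_def sym_mat_1)

lemma scaleR_vector: "(c *\<^sub>R A) *v x = c *\<^sub>R (A *v (x :: real^'n))"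
  by (simp add: scaleR_matrix_vector_assoc)

lemma psd_add: "A \<in> psd_matrices \<Longrightarrow> B \<in> psd_matrices \<Longrightarrow> A + B \<in> psd_matrices"
  by (simp add: psd_matrices_def sym_add matrix_vector_mult_add_rdistrib inner_add_right)

lemma psd_scaleR: "A \<in> psd_matrices \<Longrightarrow> 0 \<le> c \<Longrightarrow> c *\<^sub>R A \<in> psd_matrices"
  by (simp add: psd_matrices_def sym_scaleR scaleR_vector)

lemma pd_add_psd: "A \<in> pd_matrices \<Longrightarrow> B \<in> psd_matrices \<Longrightarrow> A + B \<in> pd_matrices"
  by (simp add: psd_matrices_def pd_matrices_def sym_add matrix_vector_mult_add_rdistrib
      inner_add_right add_pos_nonneg)

lemma pd_scaleR: "A \<in> pd_matrices \<Longrightarrow> 0 < c \<Longrightarrow> c *\<^sub>R A \<in> pd_matrices"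
  by (simp add: pd_matrices_def sym_scaleR scaleR_vector)

lemma psd_conj:
  assumes "M \<in> psd_matrices" shows "X ** M ** transpose X \<in> psd_matrices"
proof -
  have "x \<bullet> ((X ** M ** transpose X) *v x) = (x v* X) \<bullet> (M *v (x v* X))" for x
    by (metis dot_lmul_matrix matrix_vector_mul_assoc transpose_matrix_vector)
  then show ?thesis
    using assms by (simp add: psd_matrices_def sym_conj)
qed

lemma psd_conj_sym:
  assumes "M \<in> psd_matrices" "X \<in> sym_matrices" shows "X ** M ** X \<in> psd_matrices"
  using psd_conj [OF assms(1), of X] sym_transpose [OF assms(2)] by simp

lemma convex_psd: "convex psd_matrices"
  unfolding convex_def by (blast intro: psd_add psd_scaleR)

lemma inner_conj_columns: "(X :: real^'m^'n) \<bullet> (P ** X) = (\<Sum>j\<in>UNIV. column j X \<bullet> (P *v column j X))"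
proof -
  have "column j (P ** X) = P *v column j X" for j
    by (simp add: column_def matrix_vector_mult_def matrix_matrix_mult_def vec_eq_iff)
  then show ?thesis by (simp add: inner_matrix_columns)
qed

lemma psd_inner_conj: "P \<in> psd_matrices \<Longrightarrow> 0 \<le> (X :: real^'m^'n) \<bullet> (P ** X)"
  unfolding inner_conj_columns by (intro sum_nonneg psd_quadratic)

text \<open>This quantitative form makes the Sylvester equation in \<open>shifted_root_intertwine\<close> uniquely solvable.\<close>

lemma inner_conj_ge:
  assumes "P - c *\<^sub>R mat 1 \<in> psd_matrices"
  shows "c * (norm (X :: real^'m^'n))\<^sup>2 \<le> X \<bullet> (P ** X)"
  using psd_inner_conj [OF assms, of X]
  by (simp add: mat_ring inner_diff_right power2_norm_eq_inner)

text \<open>The matrix inverse is defined as a chosen two-sided inverse. For square matrices a one-sided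
  inverse determines it.\<close>

lemma matrix_inv_unique:
  assumes "A ** B = mat 1" shows "matrix_inv (A :: real^'n^'n) = B"
proof -
  have "B ** A = mat 1" using assms matrix_left_right_inverse by blast
  then have "A ** matrix_inv A = mat 1 \<and> matrix_inv A ** A = mat 1"
    unfolding matrix_inv_def using assms by (metis (mono_tags, lifting) someI)
  then show ?thesis
    by (metis \<open>B ** A = mat 1\<close> matrix_mul_assoc matrix_mul_lid matrix_mul_rid)
qed

lemma matrix_inv_if_trivial_kernel:
  assumes "\<And>x. (A :: real^'n^'n) *v x = 0 \<Longrightarrow> x = 0"
  shows "A ** matrix_inv A = mat 1" "matrix_inv A ** A = mat 1"
proof -
  obtain B where "B ** A = mat 1"
    using assms matrix_left_invertible_ker [of A] by auto
  then have "A ** B = mat 1" "B ** A = mat 1"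
    using matrix_left_right_inverse by blast+
  then show "A ** matrix_inv A = mat 1" "matrix_inv A ** A = mat 1"
    by (simp_all add: matrix_inv_unique)
qed

lemma pd_inv:
  assumes "A \<in> pd_matrices"
  shows "A ** matrix_inv A = mat 1" "matrix_inv A ** A = mat 1"
proof -
  have "x = 0" if "A *v x = 0" for x
    using assms that by (force simp: pd_matrices_def)
  then show "A ** matrix_inv A = mat 1" "matrix_inv A ** A = mat 1"
    by (auto intro: matrix_inv_if_trivial_kernel)
qed

lemma pd_conj:
  assumes M: "M \<in> pd_matrices" and X: "X \<in> sym_matrices" "X ** Y = mat 1"
  shows "X ** M ** X \<in> pd_matrices"
proof -
  have YX: "Y ** X = mat 1" using X matrix_left_right_inverse by blast
  have "x \<bullet> ((X ** M ** X) *v x) = (X *v x) \<bullet> (M *v (X *v x))" for x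
    using sym_inner_mult [OF X(1)] by (simp add: matrix_vector_mul_assoc [symmetric])
  moreover have "X *v x \<noteq> 0" if "x \<noteq> 0" for x
    using that YX by (metis matrix_vector_mul_assoc matrix_vector_mul_lid matrix_vector_mult_0_right)
  ultimately show ?thesis
    using M psd_sym [OF psd_conj_sym [OF pd_psd [OF M] X(1)]] by (simp add: pd_matrices_def)
qed

lemma sym_matrix_inv:
  assumes "A \<in> sym_matrices" "A ** matrix_inv A = mat 1" shows "matrix_inv A \<in> sym_matrices"
proof -
  have "transpose (matrix_inv A) ** A = mat 1"
    using assms by (metis matrix_transpose_mul sym_transpose transpose_mat)
  then have "A ** transpose (matrix_inv A) = mat 1"
    using matrix_left_right_inverse by blast
  then show ?thesis
    using matrix_inv_unique by (metis (mono_tags) mem_Collect_eq sym_matrices_def)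
qed

lemma pd_matrix_inv:
  assumes "A \<in> pd_matrices" shows "matrix_inv A \<in> pd_matrices"
proof -
  have "matrix_inv A = matrix_inv A ** A ** matrix_inv A"
    by (simp add: pd_inv [OF assms])
  then show ?thesis
    using pd_conj [OF assms sym_matrix_inv [OF pd_sym [OF assms]] pd_inv(2)] assms
    by (metis pd_inv(1))
qed

text \<open>The norm of a matrix is its Frobenius norm, which is submultiplicative.\<close>

lemma norm_matrix_vector_mult: "norm ((A :: real^'n^'m) *v x) \<le> norm A * norm x"
proof -
  have "(norm (A *v x))\<^sup>2 = (\<Sum>i\<in>UNIV. ((A $ i) \<bullet> x)\<^sup>2)"
    unfolding power2_norm_eq_inner inner_vec_def [of "A *v x"] matrix_vector_mul_component
    by (simp add: power2_eq_square)
  also have "\<dots> \<le> (\<Sum>i\<in>UNIV. (A $ i \<bullet> A $ i) * (x \<bullet> x))"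
    by (intro sum_mono Cauchy_Schwarz_ineq)
  also have "\<dots> = (norm A * norm x)\<^sup>2"
    by (simp add: power_mult_distrib power2_norm_eq_inner inner_vec_def [of A] sum_distrib_right)
  finally show ?thesis by (rule power2_le_imp_le) simp
qed

lemma norm_matrix_mult: "norm ((A :: real^'k^'m) ** (B :: real^'n^'k)) \<le> norm A * norm B"
proof -
  have col: "column j (A ** B) = A *v column j B" for j
    by (simp add: column_def matrix_vector_mult_def matrix_matrix_mult_def vec_eq_iff)
  have "(norm (A ** B))\<^sup>2 = (\<Sum>j\<in>UNIV. (norm (A *v column j B))\<^sup>2)"
    by (simp add: power2_norm_eq_inner inner_matrix_columns [of "A ** B"] col)
  also have "\<dots> \<le> (\<Sum>j\<in>UNIV. (norm A * norm (column j B))\<^sup>2)"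
    by (intro sum_mono power_mono norm_matrix_vector_mult) simp
  also have "\<dots> = (norm A * norm B)\<^sup>2"
    by (simp add: power_mult_distrib power2_norm_eq_inner [of B] inner_matrix_columns
        sum_distrib_left power2_norm_eq_inner [of "column _ _"])
  finally show ?thesis by (rule power2_le_imp_le) simp
qed

lemma bounded_bilinear_matrix_mult: "bounded_bilinear ((**) :: real^'k^'m \<Rightarrow> real^'n^'k \<Rightarrow> real^'n^'m)"
  by (rule bounded_bilinear.intro)
    (auto simp: mat_ring intro!: exI [of _ 1] norm_matrix_mult)

section \<open>The spectral theorem\<close>

text \<open>The eigenvector is a maximizer of the Rayleigh quotient on the unit sphere of the subspace.\<close>

lemma eigenvector_in_invariant_subspace:
  fixes A :: "real^'n^'n"
  assumes A: "A \<in> sym_matrices" and W: "subspace W" and inv: "\<And>x. x \<in> W \<Longrightarrow> A *v x \<in> W"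
    and nz: "W \<noteq> {0}"
  shows "\<exists>x c. x \<in> W \<and> norm x = 1 \<and> A *v x = c *\<^sub>R x"
proof -
  let ?K = "W \<inter> sphere 0 1"
  obtain y where y: "y \<in> W" "y \<noteq> 0"
    using nz subspace_0 [OF W] by blast
  have "y /\<^sub>R norm y \<in> ?K"
    using y W by (simp add: subspace_scale)
  then have "?K \<noteq> {}" by blast
  moreover have "compact ?K"
    using closed_subspace [OF W] by (intro closed_Int_compact) auto
  moreover have "continuous_on ?K (\<lambda>x. x \<bullet> (A *v x))"
    by (intro continuous_on_inner continuous_on_id linear_continuous_on matrix_vector_mul_bounded_linear)
  ultimately have "\<exists>x\<in>?K. \<forall>z\<in>?K. z \<bullet> (A *v z) \<le> x \<bullet> (A *v x)"
    by (intro continuous_attains_sup)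
  then obtain x where x: "x \<in> ?K" and max: "\<And>z. z \<in> ?K \<Longrightarrow> z \<bullet> (A *v z) \<le> x \<bullet> (A *v x)"
    by blast
  define c where "c = x \<bullet> (A *v x)"
  define r where "r = c *\<^sub>R x - A *v x"
  have x1: "norm x = 1" "x \<in> W" and xx: "x \<bullet> x = 1"
    using x by (auto simp: norm_eq_1)
  have rW: "r \<in> W"
    using x1 inv W by (simp add: r_def subspace_diff subspace_scale)
  have quad: "z \<bullet> (A *v z) \<le> c * (z \<bullet> z)" if "z \<in> W" for z
  proof (cases "z = 0")
    case False
    define u where "u = z /\<^sub>R norm z"
    have "u \<in> ?K"
      using that W False by (simp add: u_def subspace_scale)
    then have "u \<bullet> (A *v u) \<le> c"
      using max c_def by blast
    moreover have "z = norm z *\<^sub>R u"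
      using False by (simp add: u_def)
    then have "z \<bullet> (A *v z) = (norm z)\<^sup>2 * (u \<bullet> (A *v u))"
      by (metis inner_scaleR_left inner_scaleR_right matrix_vector_mult_scaleR mult.assoc power2_eq_square)
    ultimately show ?thesis
      using mult_left_mono [of "u \<bullet> (A *v u)" c "(norm z)\<^sup>2"]
      by (simp add: power2_norm_eq_inner mult.commute)
  qed simp
  have "r \<bullet> r = 0"
  proof (rule ccontr)
    assume nzr: "r \<bullet> r \<noteq> 0"
    then have pos: "r \<bullet> r > 0" by simp
    define q where "q = c * (r \<bullet> r) - r \<bullet> (A *v r)"
    \<comment> \<open>The maximality of x makes the quadratic polynomial in s below nonnegative.\<close>
    have poly: "0 \<le> 2 * s * (r \<bullet> r) + s\<^sup>2 * q" for s
    proof -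
      have "x + s *\<^sub>R r \<in> W" using x1 rW W by (simp add: subspace_add subspace_scale)
      from quad [OF this]
      have "0 \<le> c * ((x + s *\<^sub>R r) \<bullet> (x + s *\<^sub>R r)) - (x + s *\<^sub>R r) \<bullet> (A *v (x + s *\<^sub>R r))"
        by simp
      also have "\<dots> = 2 * s * (c * (r \<bullet> x) - r \<bullet> (A *v x)) + s\<^sup>2 * q"
        using sym_inner_mult [OF A, of x r]
        by (simp add: matrix_vector_right_distrib matrix_vector_mult_scaleR inner_add_left
            inner_add_right xx c_def [symmetric] q_def power2_eq_square inner_commute algebra_simps)
      also have "c * (r \<bullet> x) - r \<bullet> (A *v x) = r \<bullet> r"
        by (simp add: r_def inner_diff_right inner_diff_left)
      finally show ?thesis .
    qed
    \<comment> \<open>For this small negative s the linear term dominates, which contradicts nonnegativity.\<close>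
    define s where "s = - (r \<bullet> r) / (\<bar>q\<bar> + 1)"
    have "s < 0" using pos by (simp add: s_def field_simps)
    have "\<bar>s * q\<bar> < r \<bullet> r"
      using pos by (simp add: s_def abs_mult abs_divide field_simps)
    then have "0 < 2 * (r \<bullet> r) + s * q" using pos by linarith
    then have "2 * s * (r \<bullet> r) + s\<^sup>2 * q < 0"
      using \<open>s < 0\<close> mult_neg_pos [of s "2 * (r \<bullet> r) + s * q"]
      by (simp add: power2_eq_square algebra_simps)
    with poly [of s] show False by simp
  qed
  then have "A *v x = c *\<^sub>R x" by (simp add: r_def)
  then show ?thesis using x1 by blast
qed

text \<open>A set of orthonormal eigenvectors of greatest cardinality spans the whole space: its orthogonal
  complement is invariant, and a unit eigenvector in it would enlarge the set.\<close>

theorem symmetric_diagonalization: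
  fixes A :: "real^'n^'n"
  assumes A: "A \<in> sym_matrices"
  obtains P s where "orthogonal_matrix P" "A = P ** diag_matrix s ** transpose P"
proof -
  define \<E> where "\<E> = {E. pairwise orthogonal E \<and> (\<forall>x\<in>E. norm x = 1 \<and> (\<exists>c. A *v x = c *\<^sub>R x))}"
  have indep: "independent E" if "E \<in> \<E>" for E
    using that by (intro pairwise_orthogonal_independent) (auto simp: \<E>_def)
  have "{} \<in> \<E>" by (simp add: \<E>_def pairwise_def)
  moreover have "card E < CARD('n) + 1" if "E \<in> \<E>" for E
    using independent_bound [OF indep [OF that]] by simp
  ultimately obtain E where E: "E \<in> \<E>" and max: "\<And>E'. E' \<in> \<E> \<Longrightarrow> card E' \<le> card E"
    using Lattices_Big.ex_has_greatest_nat [of "\<lambda>E. E \<in> \<E>" "{}" card "CARD('n) + 1"] by blast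
  have fin: "finite E" using indep [OF E] independent_imp_finite by blast
  define W where "W = {y. \<forall>x\<in>E. orthogonal x y}"
  have "W = {0}"
  proof (rule ccontr)
    assume "W \<noteq> {0}"
    moreover have "subspace W"
      unfolding W_def by (rule subspace_orthogonal_to_vectors)
    moreover have "A *v y \<in> W" if "y \<in> W" for y
    proof -
      have "x \<bullet> (A *v y) = 0" if "x \<in> E" for x
      proof -
        have "\<exists>c. A *v x = c *\<^sub>R x" using E that by (simp add: \<E>_def)
        then obtain c where "A *v x = c *\<^sub>R x" by blast
        then show ?thesis
          using \<open>y \<in> W\<close> that by (simp add: sym_inner_mult [OF A] W_def orthogonal_def)
      qed
      then show ?thesis by (simp add: W_def orthogonal_def)
    qed
    ultimately obtain x c where x: "x \<in> W" "norm x = 1" "A *v x = c *\<^sub>R x"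
      using eigenvector_in_invariant_subspace [OF A] by metis
    have "x \<notin> E"
      using x by (auto simp: W_def orthogonal_def norm_eq_1)
    moreover have "insert x E \<in> \<E>"
      using E x unfolding \<E>_def
      by (auto simp: pairwise_insert W_def orthogonal_commute)
    ultimately show False
      using max [of "insert x E"] fin by simp
  qed
  have "span E = UNIV"
  proof (rule ccontr)
    assume "span E \<noteq> UNIV"
    then obtain a where a: "a \<noteq> 0" "\<forall>x \<in> span E. a \<bullet> x = 0"
      using span_not_UNIV_orthogonal by blast
    then have "a \<in> W"
      by (auto simp: W_def orthogonal_def inner_commute span_base)
    then show False using a \<open>W = {0}\<close> by blast
  qed
  then have "card E = CARD('n)"
    using dim_eq_card_independent [OF indep [OF E]] dim_span [of E] by simp
  then obtain e where e: "bij_betw e (UNIV :: 'n set) E"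
    using fin finite_same_card_bij [of "UNIV :: 'n set" E] by auto
  have eE: "e i \<in> E" for i using e by (auto simp: bij_betw_def)
  then have "\<forall>i. \<exists>c. A *v e i = c *\<^sub>R e i" using E by (auto simp: \<E>_def)
  then obtain c where c: "\<And>i. A *v e i = c i *\<^sub>R e i" by metis
  define P :: "real^'n^'n" where "P = (\<chi> i j. e j $ i)"
  have col: "column j P = e j" for j by (simp add: P_def column_def vec_eq_iff)
  have orth: "orthogonal_matrix P"
    unfolding orthogonal_matrix_orthonormal_columns col
  proof (intro conjI allI impI)
    fix i j :: 'n
    show "norm (e i) = 1" using E eE by (auto simp: \<E>_def)
    assume "i \<noteq> j"
    then have "e i \<noteq> e j" using e by (auto simp: bij_betw_def inj_on_def)
    then show "orthogonal (e i) (e j)"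
      using E eE by (auto simp: \<E>_def pairwise_def)
  qed
  have "A ** P = P ** diag_matrix (\<chi> i. c i)"
  proof -
    have "(A ** P) $ i $ j = c j * P $ i $ j" for i j
    proof -
      have "(A ** P) $ i $ j = (A *v e j) $ i"
        by (simp add: P_def matrix_matrix_mult_def matrix_vector_mult_def)
      then show ?thesis by (simp add: c P_def)
    qed
    moreover have "(P ** diag_matrix (\<chi> i. c i)) $ i $ j = c j * P $ i $ j" for i j
      by (simp add: matrix_matrix_mult_def diag_matrix_def if_distrib [of "\<lambda>x. _ * x"] mult.commute
          cong: if_cong)
    ultimately show ?thesis by (simp add: vec_eq_iff)
  qed
  then have "A = P ** diag_matrix (\<chi> i. c i) ** transpose P"
    using orth by (metis matrix_mul_assoc matrix_mul_rid orthogonal_matrix_def)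
  then show ?thesis using that orth by blast
qed

section \<open>Diagonal matrices in an orthonormal basis\<close>

lemma diag_matrix_mult: "diag_matrix s ** diag_matrix u = diag_matrix (\<chi> i. s $ i * u $ i)"
  by (simp add: matrix_matrix_mult_def diag_matrix_def vec_eq_iff if_distrib [of "\<lambda>x. _ * x"]
      if_distrib [of "\<lambda>x. x * _"] cong: if_cong)

lemma diag_matrix_add: "diag_matrix s + diag_matrix u = diag_matrix (s + u)"
  by (simp add: diag_matrix_def vec_eq_iff)

lemma diag_matrix_diff: "diag_matrix s - diag_matrix u = diag_matrix (s - u)"
  by (simp add: diag_matrix_def vec_eq_iff)

lemma diag_matrix_scaleR: "c *\<^sub>R diag_matrix s = diag_matrix (c *\<^sub>R s)"
  by (simp add: diag_matrix_def vec_eq_iff)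

lemma mat_1_diag: "mat 1 = diag_matrix (\<chi> i. 1)"
  by (simp add: diag_matrix_def mat_def vec_eq_iff)

lemma transpose_diag: "transpose (diag_matrix s) = diag_matrix s"
  by (simp add: diag_matrix_def transpose_def vec_eq_iff)

lemma det_diag: "det (diag_matrix s) = prod (\<lambda>i. s $ i) UNIV"
  by (subst det_diagonal) (auto simp: diag_matrix_def)

lemma orth_conj_mult:
  assumes "orthogonal_matrix P"
  shows "(P ** X ** transpose P) ** (P ** Y ** transpose P) = P ** (X ** Y) ** transpose P"
proof -
  have "(P ** X ** transpose P) ** (P ** Y ** transpose P) = P ** X ** (transpose P ** P) ** Y ** transpose P"
    by (simp add: matrix_mul_assoc)
  also have "\<dots> = P ** (X ** Y) ** transpose P"
    using assms by (simp add: orthogonal_matrix_def matrix_mul_assoc)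
  finally show ?thesis .
qed

lemma orth_conj_add: "(P ** X ** transpose P) + (P ** Y ** transpose P) = P ** (X + Y) ** transpose (P :: real^'n^'n)"
  by (simp add: mat_ring)

lemma orth_conj_scaleR: "c *\<^sub>R (P ** X ** transpose P) = P ** (c *\<^sub>R X) ** transpose (P :: real^'n^'n)"
  by (simp add: mat_ring)

lemma orth_conj_1: "orthogonal_matrix P \<Longrightarrow> P ** mat 1 ** transpose P = mat 1"
  by (simp add: orthogonal_matrix_def)

lemma diag_quadratic: "x \<bullet> (diag_matrix s *v x) = (\<Sum>i\<in>UNIV. s $ i * (x $ i)\<^sup>2)"
  by (simp add: inner_vec_def matrix_vector_mult_def diag_matrix_def if_distrib [of "\<lambda>x. x * _"]
      cong: if_cong) (simp add: power2_eq_square mult_ac)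

lemma psd_diag: "diag_matrix s \<in> psd_matrices \<longleftrightarrow> (\<forall>i. 0 \<le> s $ i)"
proof
  assume "diag_matrix s \<in> psd_matrices"
  then have "0 \<le> axis i 1 \<bullet> (diag_matrix s *v axis i 1)" for i
    by (rule psd_quadratic)
  moreover have "axis i 1 \<bullet> (diag_matrix s *v axis i 1) = s $ i" for i
    by (simp add: diag_quadratic axis_def if_distrib [of "\<lambda>x. x\<^sup>2"] if_distrib [of "\<lambda>x. _ * x"] cong: if_cong)
  ultimately show "\<forall>i. 0 \<le> s $ i" by simp
qed (simp add: psd_matrices_def sym_matrices_def transpose_diag diag_quadratic sum_nonneg)

lemma orth_conj_cancel:
  assumes "orthogonal_matrix P" "A = P ** M ** transpose P"
  shows "M = transpose P ** A ** transpose (transpose P)"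
proof -
  have "transpose P ** A ** P = (transpose P ** P) ** M ** (transpose P ** P)"
    by (simp add: assms(2) matrix_mul_assoc)
  then show ?thesis using assms(1) by (simp add: orthogonal_matrix_def)
qed

lemma psd_conj_diag:
  assumes "orthogonal_matrix P"
  shows "P ** diag_matrix s ** transpose P \<in> psd_matrices \<longleftrightarrow> (\<forall>i. 0 \<le> s $ i)"
  using psd_conj [of "diag_matrix s" P] psd_conj [of "P ** diag_matrix s ** transpose P" "transpose P"]
    orth_conj_cancel [OF assms refl, of "diag_matrix s"] psd_diag [of s] by auto

lemma det_orth_conj:
  assumes "orthogonal_matrix P" shows "det (P ** M ** transpose P) = det (M :: real^'n^'n)"
proof -
  have "det P * det P = 1"
    using assms by (metis det_I det_mul det_transpose orthogonal_matrix_def)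
  then show ?thesis by (simp add: det_mul)
qed

lemma trace_orth_conj:
  assumes "orthogonal_matrix P" shows "mat 1 \<bullet> (P ** M ** transpose P) = mat 1 \<bullet> (M :: real^'n^'n)"
  using assms unfolding trace_inner [symmetric] orthogonal_matrix_def
  by (subst trace_mul_sym) (simp add: matrix_mul_assoc)

lemma trace_diag: "mat 1 \<bullet> diag_matrix s = (\<Sum>i\<in>UNIV. s $ i)"
  by (simp add: trace_inner [symmetric] trace_def diag_matrix_def)

lemma pd_diag_pos:
  assumes "P ** diag_matrix s ** transpose P \<in> pd_matrices" "orthogonal_matrix P"
  shows "0 < s $ i"
proof -
  let ?A = "P ** diag_matrix s ** transpose P"
  have "0 \<le> s $ i"
    using psd_conj_diag [OF assms(2)] pd_psd [OF assms(1)] by blast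
  moreover have "s $ i \<noteq> 0"
  proof
    assume "s $ i = 0"
    then have "det ?A = 0"
      unfolding det_orth_conj [OF assms(2)] det_diag by auto
    then show False
      using pd_inv(1) [OF assms(1)] by (metis det_I det_mul mult_zero_left zero_neq_one)
  qed
  ultimately show ?thesis by simp
qed

lemma pd_det_pos: "A \<in> pd_matrices \<Longrightarrow> 0 < det A"
  by (rule symmetric_diagonalization [OF pd_sym], assumption)
    (auto simp: det_diag det_orth_conj intro!: prod_pos dest: pd_diag_pos)

section \<open>The positive semidefinite square root\<close>

text \<open>The square root is Hoelder continuous with exponent 1/2 on the closed cone. Applied to two roots
  of the same matrix, this also gives uniqueness of the root.\<close>

lemma psd_root_dist:
  fixes S T :: "real^'n^'n"
  assumes S: "S \<in> psd_matrices" and T: "T \<in> psd_matrices"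
  shows "(norm (S - T))\<^sup>2 \<le> real CARD('n) * norm (S ** S - T ** T)"
proof -
  obtain P s where P: "orthogonal_matrix P" and D: "S - T = P ** diag_matrix s ** transpose P"
    using symmetric_diagonalization [OF sym_diff [OF psd_sym psd_sym]] S T by metis
  have "(norm (S - T))\<^sup>2 = mat 1 \<bullet> ((S - T) ** (S - T))"
    using inner_mult_left [of "S - T" "mat 1" "S - T"] sym_transpose [OF sym_diff [OF psd_sym [OF S] psd_sym [OF T]]]
    by (simp add: power2_norm_eq_inner)
  also have "\<dots> = (\<Sum>i\<in>UNIV. (s $ i)\<^sup>2)"
    unfolding D by (simp add: orth_conj_mult [OF P] trace_orth_conj [OF P] diag_matrix_mult trace_diag power2_eq_square)
  also have "\<dots> \<le> (\<Sum>i\<in>(UNIV::'n set). norm (S ** S - T ** T))"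
  proof (rule sum_mono)
    fix i :: 'n
    define v where "v = column i P"
    have nv: "norm v = 1" using P by (simp add: v_def orthogonal_matrix_orthonormal_columns)
    have "(S - T) ** P = P ** diag_matrix s"
      unfolding D using P by (simp add: orthogonal_matrix_def flip: matrix_mul_assoc)
    then have "column i ((S - T) ** P) = column i (P ** diag_matrix s)" by simp
    then have eig: "(S - T) *v v = s $ i *\<^sub>R v"
      by (simp add: column_def v_def matrix_vector_mult_def matrix_matrix_mult_def vec_eq_iff
          diag_matrix_def if_distrib [of "\<lambda>x. _ * x"] mult.commute cong: if_cong)
    then have eig': "S *v v = T *v v + s $ i *\<^sub>R v"
      by (simp add: algebra_simps)
    have "v \<bullet> ((S ** S - T ** T) *v v) = (S *v v) \<bullet> (S *v v) - (T *v v) \<bullet> (T *v v)"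
      using sym_inner_mult [OF psd_sym [OF S]] sym_inner_mult [OF psd_sym [OF T]]
      by (simp add: matrix_vector_mult_diff_rdistrib matrix_vector_mul_assoc [symmetric] inner_diff_right)
    also have "\<dots> = s $ i * (v \<bullet> (S *v v) + v \<bullet> (T *v v))"
      by (simp add: eig' inner_add_left inner_add_right inner_commute algebra_simps)
    finally have 1: "v \<bullet> ((S ** S - T ** T) *v v) = s $ i * (v \<bullet> (S *v v) + v \<bullet> (T *v v))" .
    \<comment> \<open>The two quadratic forms are nonnegative and differ by the eigenvalue, so their sum is at
      least its modulus.\<close>
    have "v \<bullet> (S *v v) = v \<bullet> (T *v v) + s $ i"
      using nv by (simp add: eig' inner_add_right norm_eq_1)
    then have "\<bar>s $ i\<bar> \<le> v \<bullet> (S *v v) + v \<bullet> (T *v v)"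
      using psd_quadratic [OF S, of v] psd_quadratic [OF T, of v] by linarith
    then have "\<bar>s $ i\<bar> * \<bar>s $ i\<bar> \<le> \<bar>s $ i\<bar> * \<bar>v \<bullet> (S *v v) + v \<bullet> (T *v v)\<bar>"
      by (intro mult_left_mono) auto
    also have "\<dots> = \<bar>v \<bullet> ((S ** S - T ** T) *v v)\<bar>" by (simp add: 1 abs_mult)
    also have "\<dots> \<le> norm ((S ** S - T ** T) *v v)"
      using Cauchy_Schwarz_ineq2 [of v "(S ** S - T ** T) *v v"] nv by simp
    also have "\<dots> \<le> norm (S ** S - T ** T)"
      using norm_matrix_vector_mult [of "S ** S - T ** T" v] nv by simp
    finally show "(s $ i)\<^sup>2 \<le> norm (S ** S - T ** T)" by (simp add: power2_eq_square)
  qed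
  finally show ?thesis by simp
qed

lemma psd_sqrt_eqI:
  fixes S :: "real^'n^'n"
  assumes "S \<in> psd_matrices" "S ** S = A" shows "psd_sqrt A = S"
  unfolding psd_sqrt_def
proof (rule the_equality)
  fix T :: "real^'n^'n" assume "T \<in> psd_matrices \<and> T ** T = A"
  then have "(norm (T - S))\<^sup>2 \<le> 0"
    using psd_root_dist [of T S] assms by simp
  then show "T = S" by simp
qed (use assms in blast)

lemma psd_sqrt_diag:
  assumes "orthogonal_matrix P" "\<And>i. 0 \<le> s $ i"
  shows "psd_sqrt (P ** diag_matrix s ** transpose P) = P ** diag_matrix (\<chi> i. sqrt (s $ i)) ** transpose P"
  using assms by (intro psd_sqrt_eqI) (simp_all add: psd_conj_diag orth_conj_mult diag_matrix_mult vec_lambda_eta)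

lemma psd_sqrt:
  assumes "A \<in> psd_matrices"
  shows "psd_sqrt A \<in> psd_matrices" "psd_sqrt A ** psd_sqrt A = A"
proof -
  obtain P s where P: "orthogonal_matrix P" and A: "A = P ** diag_matrix s ** transpose P"
    using symmetric_diagonalization [OF psd_sym [OF assms]] by metis
  have s: "0 \<le> s $ i" for i using psd_conj_diag [OF P] A assms by blast
  show "psd_sqrt A \<in> psd_matrices" "psd_sqrt A ** psd_sqrt A = A"
    unfolding A psd_sqrt_diag [OF P s]
    using s by (simp_all add: psd_conj_diag P orth_conj_mult diag_matrix_mult vec_lambda_eta)
qed

lemma psd_inner_nonneg:
  assumes "A \<in> psd_matrices" "B \<in> psd_matrices" shows "0 \<le> A \<bullet> B"
proof -
  let ?b = "psd_sqrt B"
  have "A \<bullet> (?b ** ?b) = (A ** ?b) \<bullet> ?b"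
    using inner_mult_right [of A ?b ?b] inner_mult_right [of ?b ?b A]
      sym_transpose [OF psd_sym [OF psd_sqrt(1) [OF assms(2)]]] by (simp add: inner_commute)
  then show ?thesis
    using psd_inner_conj [OF assms(1), of ?b] psd_sqrt [OF assms(2)] by (simp add: inner_commute)
qed

lemma psd_sqrt_pd_inv:
  assumes "A \<in> pd_matrices"
  shows "psd_sqrt A ** matrix_inv (psd_sqrt A) = mat 1" "matrix_inv (psd_sqrt A) ** psd_sqrt A = mat 1"
proof -
  have "psd_sqrt A ** (psd_sqrt A ** matrix_inv A) = mat 1"
    by (simp add: matrix_mul_assoc psd_sqrt [OF pd_psd [OF assms]] pd_inv [OF assms])
  then have "matrix_inv (psd_sqrt A) = psd_sqrt A ** matrix_inv A"
    by (rule matrix_inv_unique)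
  then show "psd_sqrt A ** matrix_inv (psd_sqrt A) = mat 1" 
    by (simp add: matrix_mul_assoc psd_sqrt [OF pd_psd [OF assms]] pd_inv [OF assms])
  then show "matrix_inv (psd_sqrt A) ** psd_sqrt A = mat 1"
    using matrix_left_right_inverse by blast
qed

section \<open>The logarithm of the determinant\<close>

text \<open>The tangent inequality of the concave function \<open>log det\<close>, with its equality case. After the
  congruence that takes \<open>Q\<close> to the identity it is the inequality \<open>ln x \<le> x - 1\<close> for each eigenvalue.\<close>

lemma ln_det_le:
  fixes P Q :: "real^'n^'n"
  assumes P: "P \<in> pd_matrices" and Q: "Q \<in> pd_matrices"
  shows "ln (det P) \<le> ln (det Q) + matrix_inv Q \<bullet> (P - Q)"
    and "P \<noteq> Q \<Longrightarrow> ln (det P) < ln (det Q) + matrix_inv Q \<bullet> (P - Q)"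
proof -
  define q where "q = psd_sqrt Q"
  define r where "r = matrix_inv q"
  have qr: "q ** r = mat 1" "r ** q = mat 1"
    unfolding q_def r_def using psd_sqrt_pd_inv [OF Q] by auto
  have qs: "q \<in> sym_matrices" "q ** q = Q"
    using psd_sqrt [OF pd_psd [OF Q]] psd_sym by (auto simp: q_def)
  have rs: "r \<in> sym_matrices" using sym_matrix_inv qs qr by (simp add: r_def)
  have "Q ** (r ** r) = q ** (q ** r) ** r"
    by (simp add: qs(2) [symmetric] matrix_mul_assoc)
  then have Qi: "matrix_inv Q = r ** r"
    by (intro matrix_inv_unique) (simp add: qr)
  define N where "N = r ** P ** r"
  have PN: "P = q ** N ** q"
  proof -
    have "q ** N ** q = (q ** r) ** P ** (r ** q)" by (simp add: N_def matrix_mul_assoc)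
    then show ?thesis by (simp add: qr)
  qed
  have N: "N \<in> pd_matrices" unfolding N_def using pd_conj [OF P rs qr(2)] .
  obtain V s where V: "orthogonal_matrix V" and Ns: "N = V ** diag_matrix s ** transpose V"
    using symmetric_diagonalization [OF pd_sym [OF N]] by metis
  have s: "0 < s $ i" for i using pd_diag_pos V N unfolding Ns by blast
  have detQ: "0 < det Q" using pd_det_pos [OF Q] .
  have "det P = det Q * det N"
    unfolding PN qs(2) [symmetric] by (simp add: det_mul)
  moreover have "det N = (\<Prod>i\<in>UNIV. s $ i)" unfolding Ns det_orth_conj [OF V] det_diag ..
  ultimately have lhs: "ln (det P) = ln (det Q) + (\<Sum>i\<in>UNIV. ln (s $ i))"
    using detQ s by (simp add: ln_mult prod_pos ln_prod less_imp_neq [symmetric])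
  have "matrix_inv Q \<bullet> P = mat 1 \<bullet> N"
    using inner_mult_left [of r r P] inner_mult_left [of r "mat 1" "P ** r"] inner_mult_right [of r r P]
      inner_mult_right [of "mat 1" r "r ** P"] sym_transpose [OF rs]
    by (simp add: Qi N_def matrix_mul_assoc)
  moreover have "matrix_inv Q \<bullet> Q = mat 1 \<bullet> (mat 1 :: real^'n^'n)"
    using inner_mult_right [of "mat 1" "matrix_inv Q" Q] pd_inv [OF Q] sym_transpose [OF pd_sym [OF pd_matrix_inv [OF Q]]]
    by (metis inner_commute matrix_mul_lid)
  ultimately have "matrix_inv Q \<bullet> (P - Q) = mat 1 \<bullet> N - real CARD('n)"
    by (simp add: inner_diff_right inner_mat_1)
  also have "\<dots> = (\<Sum>i\<in>UNIV. s $ i - 1)"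
    by (simp add: Ns trace_orth_conj [OF V] trace_diag sum_subtractf)
  finally have rhs: "matrix_inv Q \<bullet> (P - Q) = (\<Sum>i\<in>UNIV. s $ i - 1)" .
  have "(\<Sum>i\<in>UNIV. ln (s $ i)) \<le> (\<Sum>i\<in>UNIV. s $ i - 1)"
    using s by (intro sum_mono ln_le_minus_one)
  then show "ln (det P) \<le> ln (det Q) + matrix_inv Q \<bullet> (P - Q)" by (simp add: lhs rhs)
  assume "P \<noteq> Q"
  have "\<exists>i. s $ i \<noteq> 1"
  proof (rule ccontr)
    assume "\<not> (\<exists>i. s $ i \<noteq> 1)"
    then have "diag_matrix s = mat 1" by (simp add: mat_1_diag vec_eq_iff diag_matrix_def)
    then have "N = mat 1" using V by (simp only: Ns orth_conj_1)
    then show False using PN qs \<open>P \<noteq> Q\<close> by simp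
  qed
  then obtain i where "s $ i \<noteq> 1" ..
  then have "ln (s $ i) < s $ i - 1"
    using s ln_eq_minus_one [of "s $ i"] ln_le_minus_one [of "s $ i"] by fastforce
  then have "(\<Sum>i\<in>UNIV. ln (s $ i)) < (\<Sum>i\<in>UNIV. s $ i - 1)"
    using s by (intro sum_strict_mono_ex1) (auto intro: ln_le_minus_one)
  then show "ln (det P) < ln (det Q) + matrix_inv Q \<bullet> (P - Q)" by (simp add: lhs rhs)
qed

text \<open>Both sides depend continuously on \<open>P\<close>. For positive definite \<open>P\<close> the two matrices are similar;
  the semidefinite case is the limit along \<open>P + e Id\<close> as \<open>e\<close> decreases to 0.\<close>

lemma det_swap_psd:
  fixes P Q :: "real^'n^'n"
  assumes P: "P \<in> psd_matrices"
  shows "det (c *\<^sub>R mat 1 + P ** Q) = det (c *\<^sub>R mat 1 + Q ** P)"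
proof -
  have pd: "det (c *\<^sub>R mat 1 + R ** Q) = det (c *\<^sub>R mat 1 + Q ** R)" if R: "R \<in> pd_matrices" for R
  proof -
    have "c *\<^sub>R mat 1 + R ** Q = R ** (c *\<^sub>R mat 1 + Q ** R) ** matrix_inv R"
      using pd_inv [OF R] by (simp add: mat_ring flip: matrix_mul_assoc)
    moreover have "det R * det (matrix_inv R) = 1"
      using pd_inv [OF R] by (metis det_I det_mul)
    ultimately show ?thesis by (simp add: det_mul)
  qed
  define f where "f = (\<lambda>e. det (c *\<^sub>R mat 1 + (P + e *\<^sub>R mat 1) ** Q)
    - det (c *\<^sub>R mat 1 + Q ** (P + e *\<^sub>R mat 1)))"
  have "continuous_on UNIV f"
    unfolding f_def det_def matrix_matrix_mult_def
    by (simp add: vector_add_component) (intro continuous_intros)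
  then have "(f \<longlongrightarrow> f 0) (at_right 0)"
    by (auto simp: continuous_on_def intro: tendsto_within_subset)
  moreover have "eventually (\<lambda>e. f e = 0) (at_right 0)"
    using eventually_at_right_less [of 0]
  proof eventually_elim
    case (elim e)
    have "e *\<^sub>R mat 1 + P \<in> pd_matrices"
      using elim by (intro pd_add_psd pd_scaleR pd_mat_1 P)
    from pd [OF this] show ?case by (simp add: f_def add.commute)
  qed
  ultimately have "f 0 = 0"
    using tendsto_unique [OF trivial_limit_at_right_real] tendsto_eventually by blast
  then show ?thesis by (simp add: f_def)
qed

section \<open>The resolvent of the shifted square root\<close>

lemma inner_sym_left: "P \<in> sym_matrices \<Longrightarrow> (P ** Y) \<bullet> Z = Y \<bullet> (P ** (Z :: real^'n^'n))"
  by (simp add: inner_mult_left sym_transpose)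

lemma inner_sym_right: "P \<in> sym_matrices \<Longrightarrow> (Y ** P) \<bullet> Z = Y \<bullet> ((Z :: real^'n^'n) ** P)"
  by (simp add: inner_mult_right sym_transpose)

text \<open>The square root \<open>S(M)\<close> of \<open>M + (t\<^sup>2/4) Id\<close>, and the inverse \<open>K(M)\<close> of \<open>S(M) + (t/2) Id\<close>. Both are
  meant for positive semidefinite \<open>M\<close> and \<open>t > 0\<close>. The shift keeps \<open>S(M)\<close> above \<open>t/2\<close>, and so \<open>K(M)\<close> exists
  and is at most \<open>Id/t\<close>.\<close>

definition shifted_root :: "real \<Rightarrow> real^'n^'n \<Rightarrow> real^'n^'n" where
  "shifted_root t M = psd_sqrt (M + (t\<^sup>2 / 4) *\<^sub>R mat 1)"

definition resolvent :: "real \<Rightarrow> real^'n^'n \<Rightarrow> real^'n^'n" where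
  "resolvent t M = matrix_inv (shifted_root t M + (t / 2) *\<^sub>R mat 1)"

lemma shifted_psd: "M \<in> psd_matrices \<Longrightarrow> M + (t\<^sup>2 / 4) *\<^sub>R mat 1 \<in> psd_matrices"
  by (intro psd_add psd_scaleR psd_mat_1) auto

lemma shifted_root_psd: "M \<in> psd_matrices \<Longrightarrow> shifted_root t M \<in> psd_matrices"
  by (simp add: shifted_root_def psd_sqrt shifted_psd)

lemma shifted_root_sq:
  "M \<in> psd_matrices \<Longrightarrow> shifted_root t M ** shifted_root t M = M + (t\<^sup>2 / 4) *\<^sub>R mat 1"
  by (simp add: shifted_root_def psd_sqrt shifted_psd)

lemma scaleR_1_orth_conj:
  assumes "orthogonal_matrix P"
  shows "c *\<^sub>R mat 1 = P ** diag_matrix (\<chi> i. c) ** transpose P"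
proof -
  have "c *\<^sub>R mat 1 = diag_matrix (\<chi> i. c)"
    by (simp add: mat_1_diag diag_matrix_scaleR diag_matrix_def vec_eq_iff)
  then show ?thesis
    using orth_conj_1 [OF assms] by (metis orth_conj_scaleR)
qed

lemma shifted_root_diag:
  fixes P :: "real^'n^'n"
  assumes P: "orthogonal_matrix P" and s: "\<And>i. 0 \<le> s $ i"
  shows "shifted_root t (P ** diag_matrix s ** transpose P)
    = P ** diag_matrix (\<chi> i. sqrt (s $ i + t\<^sup>2 / 4)) ** transpose P"
proof -
  have "s + (\<chi> i. t\<^sup>2 / 4) = (\<chi> i. s $ i + t\<^sup>2 / 4)"
    by (simp add: vec_eq_iff)
  then have "P ** diag_matrix s ** transpose P + (t\<^sup>2 / 4) *\<^sub>R mat 1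
      = P ** diag_matrix (\<chi> i. s $ i + t\<^sup>2 / 4) ** transpose P"
    by (simp only: scaleR_1_orth_conj [OF P] orth_conj_add diag_matrix_add)
  then show ?thesis
    using s by (simp add: shifted_root_def psd_sqrt_diag [OF P])
qed

lemma shifted_root_ge:
  assumes M: "M \<in> psd_matrices" and t: "0 < t"
  shows "shifted_root t M - (t / 2) *\<^sub>R mat 1 \<in> psd_matrices"
proof -
  obtain P s where P: "orthogonal_matrix P" and Ms: "M = P ** diag_matrix s ** transpose P"
    using symmetric_diagonalization [OF psd_sym [OF M]] by metis
  have s: "0 \<le> s $ i" for i using psd_conj_diag [OF P] Ms M by blast
  have "shifted_root t M - (t / 2) *\<^sub>R mat 1
      = P ** diag_matrix ((\<chi> i. sqrt (s $ i + t\<^sup>2 / 4)) - (\<chi> i. t / 2)) ** transpose P"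
    unfolding Ms shifted_root_diag [OF P s] scaleR_1_orth_conj [OF P]
    by (simp add: mat_ring diag_matrix_diff [symmetric])
  moreover have "t / 2 \<le> sqrt (s $ i + t\<^sup>2 / 4)" for i
    using s [of i] t by (intro real_le_rsqrt) (simp add: power_divide)
  ultimately show ?thesis
    by (simp add: psd_conj_diag [OF P])
qed

text \<open>Everything below about \<open>S\<close>, \<open>K\<close> and \<open>T = S + (t/2) Id = K\<^sup>-\<^sup>1\<close> rests on the factorization
  \<open>M = S\<^sup>2 - (t/2)\<^sup>2 Id = (T - t Id) T\<close>.\<close>

lemma resolvent_props:
  assumes M: "M \<in> psd_matrices" and t: "0 < t"
  defines "S \<equiv> shifted_root t M" and "K \<equiv> resolvent t M"
  defines "T \<equiv> S + (t / 2) *\<^sub>R mat 1"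
  shows shifted_root_plus_pd: "T \<in> pd_matrices"
    and resolvent_pd: "K \<in> pd_matrices"
    and resolvent_inverse: "K ** T = mat 1" "T ** K = mat 1"
    and shifted_root_plus_sq: "T ** T - t *\<^sub>R T = M"
    and resolvent_mult: "K ** M = S - (t / 2) *\<^sub>R mat 1" "M ** K = S - (t / 2) *\<^sub>R mat 1"
    and resolvent_conj: "K ** M ** K = mat 1 - t *\<^sub>R K"
    and resolvent_le: "mat 1 - t *\<^sub>R K \<in> psd_matrices"
proof -
  show T: "T \<in> pd_matrices"
    using pd_add_psd [OF pd_scaleR [OF pd_mat_1] shifted_root_psd [OF M, of t], of "t / 2"] t
    by (simp add: T_def S_def add.commute)
  have K: "K = matrix_inv T" by (simp add: K_def resolvent_def T_def S_def)
  show Kp: "K \<in> pd_matrices" unfolding K by (rule pd_matrix_inv [OF T])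
  show KT: "K ** T = mat 1" and TK: "T ** K = mat 1" using pd_inv [OF T] by (auto simp: K)
  have SS: "S ** S = M + (t\<^sup>2 / 4) *\<^sub>R mat 1" using shifted_root_sq [OF M] by (simp add: S_def)
  have TT: "T ** T = M + (t\<^sup>2 / 4) *\<^sub>R mat 1 + (t/2) *\<^sub>R S + (t/2) *\<^sub>R S + (t/2*(t/2)) *\<^sub>R mat 1"
    by (simp only: T_def mat_ring matrix_mul_lid matrix_mul_rid SS scaleR_add_right scaleR_scaleR add_ac)
  have "t *\<^sub>R T = (t/2) *\<^sub>R S + (t/2) *\<^sub>R S + (t/2*(t/2)) *\<^sub>R mat 1 + (t\<^sup>2/4) *\<^sub>R mat 1"
    unfolding T_def vec_eq_iff by (intro allI) (simp add: power2_eq_square field_simps)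
  then show M2: "T ** T - t *\<^sub>R T = M" using TT by simp
  have "K ** M = (K ** T) ** T - t *\<^sub>R (K ** T)" "M ** K = T ** (T ** K) - t *\<^sub>R (T ** K)"
    unfolding M2 [symmetric] by (simp_all add: mat_ring)
  moreover have "T - t *\<^sub>R mat 1 = S - (t/2) *\<^sub>R mat 1"
    by (simp add: T_def vec_eq_iff algebra_simps)
  ultimately show KM: "K ** M = S - (t / 2) *\<^sub>R mat 1" and MK: "M ** K = S - (t / 2) *\<^sub>R mat 1"
    using KT TK by simp_all
  have "K ** M ** K = (T - t *\<^sub>R mat 1) ** K"
    using KM \<open>T - t *\<^sub>R mat 1 = S - (t/2) *\<^sub>R mat 1\<close> by simp
  then show KMK: "K ** M ** K = mat 1 - t *\<^sub>R K" using TK by (simp add: mat_ring)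
  show "mat 1 - t *\<^sub>R K \<in> psd_matrices"
    unfolding KMK [symmetric] by (rule psd_conj_sym [OF M pd_sym [OF Kp]])
qed

lemma resolvent_psd: "M \<in> psd_matrices \<Longrightarrow> 0 < t \<Longrightarrow> resolvent t M \<in> psd_matrices"
  by (rule pd_psd [OF resolvent_pd])

section \<open>The spectral function and its symmetry\<close>

text \<open>The function \<open>H(M) = t log det (S(M) + (t/2) Id) - 2 tr S(M)\<close>, which is the part of the entropic cost
  that couples the two arguments; the trace is written as an inner product with the identity.\<close>

definition bures_spectral :: "real \<Rightarrow> real^'n^'n \<Rightarrow> real" where
  "bures_spectral t M = t * ln (det (shifted_root t M + (t / 2) *\<^sub>R mat 1)) - 2 * (mat 1 \<bullet> shifted_root t M)"

text \<open>Convexity of \<open>H\<close>, in the form of a tangent inequality with gradient \<open>-K(M)\<close>. In terms of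
  \<open>T = S(M) + (t/2) Id\<close> and \<open>T\<^sub>0\<close> defined alike from \<open>M\<^sub>0\<close>, the tangent inequality of \<open>log det\<close> bounds the
  difference of the two sides from below by the inner product of the positive semidefinite matrices
  \<open>(T - T\<^sub>0) T\<^sub>0\<^sup>-\<^sup>1 (T - T\<^sub>0)\<close> and \<open>Id - t T\<^sup>-\<^sup>1\<close>.\<close>

lemma bures_spectral_tangent:
  fixes M :: "real^'n^'n"
  assumes M: "M \<in> psd_matrices" and M0: "M0 \<in> psd_matrices" and t: "0 < t"
  shows "bures_spectral t M0 - resolvent t M0 \<bullet> (M - M0) \<le> bures_spectral t M"
proof -
  define T where "T = shifted_root t M + (t / 2) *\<^sub>R mat 1"
  define T0 where "T0 = shifted_root t M0 + (t / 2) *\<^sub>R mat 1"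
  define K where "K = resolvent t M"
  define K0 where "K0 = resolvent t M0"
  note props = shifted_root_plus_pd [OF M t, folded T_def] shifted_root_plus_pd [OF M0 t, folded T0_def]
    resolvent_pd [OF M t, folded K_def] resolvent_pd [OF M0 t, folded K0_def]
  note inv = resolvent_inverse [OF M t, folded T_def K_def] resolvent_inverse [OF M0 t, folded T0_def K0_def]
  note sq = shifted_root_plus_sq [OF M t, folded T_def] shifted_root_plus_sq [OF M0 t, folded T0_def]
  note sym = props [THEN pd_sym]
  have K: "K = matrix_inv T" using matrix_inv_unique [OF inv(2)] by simp
  define N where "N = (T - T0) ** K0 ** (T - T0)"
  have N: "N \<in> psd_matrices"
    unfolding N_def by (intro psd_conj_sym pd_psd props sym_diff sym)
  have Nexp: "N = T ** K0 ** T - 2 *\<^sub>R T + T0"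
  proof -
    have "N = T ** K0 ** T - T ** (K0 ** T0) - (T0 ** K0) ** T + T0 ** (K0 ** T0)"
      by (simp add: N_def mat_ring)
    then show ?thesis by (simp add: inv scaleR_2)
  qed
  have "0 \<le> N \<bullet> (mat 1 - t *\<^sub>R K)"
    using psd_inner_nonneg [OF N resolvent_le [OF M t]] by (simp add: K_def)
  moreover have "N \<bullet> mat 1 = K0 \<bullet> (T ** T) - 2 * (mat 1 \<bullet> T) + mat 1 \<bullet> T0"
    using inner_sym_right [OF sym(1), of "T ** K0" "mat 1"] inner_sym_left [OF sym(1), of K0 T]
    by (simp add: Nexp inner_diff_left inner_add_left) (simp add: inner_commute)
  moreover have "N \<bullet> K = K0 \<bullet> T - 2 * real CARD('n) + K \<bullet> T0"
  proof -
    have "(T ** K0 ** T) \<bullet> K = K0 \<bullet> T"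
      using inner_sym_right [OF sym(1), of "T ** K0" "K"] inner_sym_left [OF sym(1), of K0 "mat 1"]
      by (simp add: inv)
    moreover have "T \<bullet> K = real CARD('n)"
      using inner_sym_right [OF sym(1), of "mat 1" "K"] by (simp add: inv inner_mat_1)
    ultimately show ?thesis
      by (simp add: Nexp inner_diff_left inner_add_left) (simp add: inner_commute)
  qed
  moreover have "ln (det T0) \<le> ln (det T) + K \<bullet> (T0 - T)"
    using ln_det_le(1) [OF props(2,1)] by (simp add: K)
  then have "t * ln (det T0) \<le> t * (ln (det T) + K \<bullet> (T0 - T))"
    using t by (intro mult_left_mono) auto
  moreover have "K \<bullet> T = real CARD('n)"
    using inner_sym_right [OF sym(3), of "mat 1" "T"] by (simp add: inv inner_mat_1)
  moreover have "K0 \<bullet> (M - M0) = K0 \<bullet> (T ** T) - t * (K0 \<bullet> T) - mat 1 \<bullet> T0 + t * real CARD('n)"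
  proof -
    have "K0 \<bullet> T0 = real CARD('n)"
      using inner_sym_right [OF sym(4), of "mat 1" "T0"] by (simp add: inv inner_mat_1)
    moreover have "K0 \<bullet> (T0 ** T0) = mat 1 \<bullet> T0"
      using inner_sym_left [OF sym(2), of T0 K0] by (simp add: inv inner_commute)
    ultimately show ?thesis
      unfolding sq [symmetric] by (simp add: inner_diff_right)
  qed
  moreover have "mat 1 \<bullet> shifted_root t M = mat 1 \<bullet> T - t / 2 * real CARD('n)"
    "mat 1 \<bullet> shifted_root t M0 = mat 1 \<bullet> T0 - t / 2 * real CARD('n)"
    by (simp_all add: T_def T0_def inner_add_right inner_mat_1)
  ultimately show ?thesis
    unfolding bures_spectral_def T_def [symmetric] T0_def [symmetric] K0_def [symmetric]
    by (simp add: inner_diff_right algebra_simps)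
qed

text \<open>The defect \<open>Y = S\<^sub>1 X - X S\<^sub>2\<close> solves \<open>S\<^sub>1 Y + Y S\<^sub>2 = 0\<close>; pairing this equation with \<open>Y\<close> gives \<open>Y = 0\<close>, as \<open>S\<^sub>1\<close>
  is bounded below by \<open>t/2\<close> and \<open>S\<^sub>2\<close> is positive semidefinite.\<close>

lemma shifted_root_intertwine:
  fixes M1 M2 :: "real^'n^'n"
  assumes M1: "M1 \<in> psd_matrices" and M2: "M2 \<in> psd_matrices" and t: "0 < t"
    and X: "M1 ** X = X ** M2"
  shows "shifted_root t M1 ** X = X ** shifted_root t M2"
proof -
  define S1 where "S1 = shifted_root t M1"
  define S2 where "S2 = shifted_root t M2"
  define Y where "Y = S1 ** X - X ** S2"
  have "S1 ** Y + Y ** S2 = (S1 ** S1) ** X - X ** (S2 ** S2)"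
    by (simp add: Y_def mat_ring)
  also have "\<dots> = 0"
    unfolding S1_def S2_def shifted_root_sq [OF M1] shifted_root_sq [OF M2] by (simp add: mat_ring X)
  finally have "Y \<bullet> (S1 ** Y + Y ** S2) = 0" by simp
  moreover have "(t/2) * (norm Y)\<^sup>2 \<le> Y \<bullet> (S1 ** Y)"
    using inner_conj_ge [OF shifted_root_ge [OF M1 t]] by (simp add: S1_def)
  moreover have "0 \<le> Y \<bullet> (Y ** S2)"
  proof -
    have "Y \<bullet> (Y ** S2) = transpose Y \<bullet> (S2 ** transpose Y)"
      using inner_transpose [of Y "Y ** S2"] sym_transpose [OF psd_sym [OF shifted_root_psd [OF M2, of t]]]
      by (simp add: matrix_transpose_mul S2_def)
    then show ?thesis using psd_inner_conj [OF shifted_root_psd [OF M2, of t]] by (simp add: S2_def)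
  qed
  ultimately have "t * (norm Y)\<^sup>2 \<le> 0" by (simp add: inner_add_right)
  then have "Y = 0" using t by (simp add: mult_le_0_iff)
  then show ?thesis by (simp add: Y_def S1_def S2_def)
qed

lemma resolvent_intertwine:
  fixes M1 M2 :: "real^'n^'n"
  assumes M1: "M1 \<in> psd_matrices" and M2: "M2 \<in> psd_matrices" and t: "0 < t"
    and X: "M1 ** X = X ** M2"
  shows "resolvent t M1 ** X = X ** resolvent t M2"
proof -
  let ?T1 = "shifted_root t M1 + (t/2) *\<^sub>R mat 1" and ?T2 = "shifted_root t M2 + (t/2) *\<^sub>R mat 1"
  let ?K1 = "resolvent t M1" and ?K2 = "resolvent t M2"
  have "?T1 ** X = X ** ?T2"
    by (simp add: mat_ring shifted_root_intertwine [OF assms])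
  then have "?K1 ** (X ** ?T2) ** ?K2 = ?K1 ** (?T1 ** X) ** ?K2" by simp
  then have "?K1 ** X ** (?T2 ** ?K2) = (?K1 ** ?T1) ** X ** ?K2" by (simp add: matrix_mul_assoc)
  then show ?thesis by (simp add: resolvent_inverse [OF M1 t] resolvent_inverse [OF M2 t])
qed

text \<open>The matrix \<open>\<Phi>(A,B) = B\<^sup>1\<^sup>/\<^sup>2 K(B\<^sup>1\<^sup>/\<^sup>2 A B\<^sup>1\<^sup>/\<^sup>2) B\<^sup>1\<^sup>/\<^sup>2\<close>. The gradient of the entropic cost in its first argument
  at \<open>(A,B)\<close> is \<open>Id - \<Phi>(A,B)\<close>. For positive definite matrices \<open>\<Phi>(A,B)\<close> is symmetric and defines the linear
  map from \<open>N(0,A)\<close> towards \<open>N(0,B)\<close> given by the conditional mean of the optimal coupling.\<close>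

definition transport :: "real \<Rightarrow> real^'n^'n \<Rightarrow> real^'n^'n \<Rightarrow> real^'n^'n" where
  "transport t A B = psd_sqrt B ** resolvent t (psd_sqrt B ** A ** psd_sqrt B) ** psd_sqrt B"

text \<open>In this block \<open>M\<^sub>1 = a B a\<close> and \<open>M\<^sub>2 = b A b\<close>, with indices 1 and 2 on \<open>K\<close> and \<open>S\<close> accordingly. The names
  \<open>a, b, M\<^sub>1, \<dots>\<close> are replaced by their definitions in the exported facts.\<close>

context
  fixes t :: real and A B a b M1 M2 K1 K2 S1 S2 C :: "real^'n^'n"
  assumes t: "0 < t" and A: "A \<in> psd_matrices" and B: "B \<in> psd_matrices"
  defines "a \<equiv> psd_sqrt A" and "b \<equiv> psd_sqrt B"
  defines "M1 \<equiv> a ** B ** a" and "M2 \<equiv> b ** A ** b"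
  defines "K1 \<equiv> resolvent t M1" and "K2 \<equiv> resolvent t M2"
  defines "S1 \<equiv> shifted_root t M1" and "S2 \<equiv> shifted_root t M2"
  defines "C \<equiv> transport t B A ** B"
begin

lemma psd_sqrt_symmetric: "a \<in> sym_matrices" "b \<in> sym_matrices"
  using psd_sqrt(1) [OF A] psd_sqrt(1) [OF B] by (auto simp: a_def b_def psd_sym)

lemma psd_sqrt_square: "a ** a = A" "b ** b = B"
  using psd_sqrt(2) [OF A] psd_sqrt(2) [OF B] by (auto simp: a_def b_def)

lemma sqrt_conj_psd: "M1 \<in> psd_matrices" "M2 \<in> psd_matrices"
  by (auto simp: M1_def M2_def A B psd_conj_sym psd_sqrt_symmetric)

lemma sqrt_conj_intertwine: "M1 ** (a ** b) = (a ** b) ** M2"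
  by (simp add: M1_def M2_def matrix_mul_assoc flip: psd_sqrt_square)

lemma resolvent_sqrt_intertwine: "K1 ** (a ** b) = (a ** b) ** K2"
  unfolding K1_def K2_def by (rule resolvent_intertwine [OF sqrt_conj_psd t sqrt_conj_intertwine])

lemma transport_alt: "transport t A B = b ** K2 ** b" "transport t B A = a ** K1 ** a"
  by (simp_all add: transport_def a_def b_def K1_def K2_def M1_def M2_def)

lemma transport_swap: "transport t B A ** B = A ** transport t A B"
proof -
  have "transport t B A ** B = a ** (K1 ** (a ** b)) ** b"
    unfolding transport_alt by (simp add: matrix_mul_assoc flip: psd_sqrt_square)
  also have "\<dots> = A ** transport t A B"
    unfolding resolvent_sqrt_intertwine transport_alt by (simp add: matrix_mul_assoc flip: psd_sqrt_square)
  finally show ?thesis .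
qed

text \<open>The two identities are obtained from \<open>S - (t/2) Id = K M = M K\<close>: factors can be exchanged cyclically under
  the trace and in the determinant of \<open>t Id + _\<close>, and \<open>a b\<close> can be moved across \<open>K\<close>. No inverse of \<open>a\<close> or \<open>b\<close> is needed.\<close>

lemma trace_shifted_root_sym: "mat 1 \<bullet> S1 = mat 1 \<bullet> S2"
proof -
  have "trace (K1 ** M1) = trace (K1 ** (a ** b) ** (b ** a))"
    by (simp add: M1_def matrix_mul_assoc flip: psd_sqrt_square)
  also have "\<dots> = trace ((b ** a) ** ((a ** b) ** K2))"
    unfolding resolvent_sqrt_intertwine by (rule trace_mul_sym)
  also have "\<dots> = trace (M2 ** K2)"
    by (simp add: M2_def matrix_mul_assoc flip: psd_sqrt_square)
  finally show ?thesis
    unfolding K1_def K2_def resolvent_mult [OF sqrt_conj_psd(1) t] resolvent_mult [OF sqrt_conj_psd(2) t]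
    by (simp add: trace_inner inner_diff_right S1_def S2_def)
qed

lemma det_shifted_root_sym: "det (S1 + (t / 2) *\<^sub>R mat 1) = det (S2 + (t / 2) *\<^sub>R mat 1)"
proof -
  have half: "S + (t / 2) *\<^sub>R mat 1 = t *\<^sub>R mat 1 + (S - (t / 2) *\<^sub>R mat 1)" for S :: "real^'n^'n"
    by (simp add: vec_eq_iff algebra_simps)
  have "det (S1 + (t / 2) *\<^sub>R mat 1) = det (t *\<^sub>R mat 1 + (K1 ** a ** B) ** a)"
    unfolding half using resolvent_mult(1) [OF sqrt_conj_psd(1) t]
    by (simp add: S1_def K1_def M1_def matrix_mul_assoc)
  also have "\<dots> = det (t *\<^sub>R mat 1 + a ** (K1 ** a ** B))"
    using det_swap_psd [of a t "K1 ** a ** B"] psd_sqrt(1) [OF A] by (simp add: a_def)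
  also have "a ** (K1 ** a ** B) = transport t B A ** B"
    by (simp add: transport_alt matrix_mul_assoc)
  also have "\<dots> = A ** b ** K2 ** b"
    by (simp add: transport_swap) (simp add: transport_alt matrix_mul_assoc)
  also have "det (t *\<^sub>R mat 1 + A ** b ** K2 ** b) = det (t *\<^sub>R mat 1 + b ** (A ** b ** K2))"
    using det_swap_psd [of b t "A ** b ** K2"] psd_sqrt(1) [OF B] by (simp add: b_def)
  also have "\<dots> = det (S2 + (t / 2) *\<^sub>R mat 1)"
    unfolding half using resolvent_mult(2) [OF sqrt_conj_psd(2) t]
    by (simp add: S2_def K2_def M2_def matrix_mul_assoc)
  finally show ?thesis .
qed

lemma bures_spectral_sym: "bures_spectral t M1 = bures_spectral t M2"
  using trace_shifted_root_sym det_shifted_root_sym by (simp add: bures_spectral_def S1_def S2_def)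

section \<open>The matrix C and its shifts\<close>

lemma C_mult_sqrt: "C ** a = a ** (S1 - (t / 2) *\<^sub>R mat 1)"
proof -
  have "C ** a = a ** (K1 ** M1)"
    by (simp add: transport_alt C_def M1_def matrix_mul_assoc)
  then show ?thesis by (simp add: K1_def resolvent_mult [OF sqrt_conj_psd(1) t] S1_def)
qed

lemma sqrt_mult_C: "a ** B ** C = (S1 - (t / 2) *\<^sub>R mat 1) ** (a ** B)"
proof -
  have "a ** B ** C = (M1 ** K1) ** (a ** B)"
    by (simp add: transport_alt C_def M1_def matrix_mul_assoc)
  then show ?thesis by (simp add: K1_def resolvent_mult [OF sqrt_conj_psd(1) t] S1_def)
qed

lemma C_square: "C ** C = A ** B - t *\<^sub>R C"
proof -
  have "C ** C = a ** (K1 ** M1 ** K1) ** a ** B"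
    by (simp add: transport_alt C_def M1_def matrix_mul_assoc)
  also have "\<dots> = (a ** a) ** B - t *\<^sub>R (a ** K1 ** a ** B)"
    unfolding K1_def resolvent_conj [OF sqrt_conj_psd(1) t] by (simp add: mat_ring)
  finally show ?thesis by (simp add: psd_sqrt_square transport_alt C_def)
qed

lemma root_C_sq: "(C + (t / 2) *\<^sub>R mat 1) ** (C + (t / 2) *\<^sub>R mat 1) = A ** B + (t\<^sup>2 / 4) *\<^sub>R mat 1"
proof -
  have "(C + (t / 2) *\<^sub>R mat 1) ** (C + (t / 2) *\<^sub>R mat 1) 
      = C ** C + (t / 2) *\<^sub>R C + (t / 2) *\<^sub>R C + (t / 2 * (t / 2)) *\<^sub>R mat 1"
    by (simp only: mat_ring matrix_mul_lid matrix_mul_rid scaleR_add_right scaleR_scaleR add_ac)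
  also have "\<dots> = A ** B + (t\<^sup>2 / 4) *\<^sub>R mat 1"
    unfolding C_square vec_eq_iff by (intro allI) (simp add: power2_eq_square field_simps)
  finally show ?thesis .
qed

lemma transport_mult_C: "transport t A B ** (C + t *\<^sub>R mat 1) = B"
proof -
  have "transport t A B ** C = b ** (K2 ** M2 ** K2) ** b"
    by (simp add: C_def transport_swap) (simp add: transport_alt C_def M2_def matrix_mul_assoc)
  also have "\<dots> = B - t *\<^sub>R transport t A B"
    unfolding K2_def resolvent_conj [OF sqrt_conj_psd(2) t]
    by (simp add: mat_ring psd_sqrt_square transport_alt C_def K2_def)
  finally show ?thesis by (simp add: mat_ring)
qed

lemma C_mult_transport: "(C + t *\<^sub>R mat 1) ** transport t B A = A"
proof -
  have "C ** transport t B A = a ** (K1 ** M1 ** K1) ** a"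
    by (simp add: transport_alt C_def M1_def matrix_mul_assoc)
  also have "\<dots> = A - t *\<^sub>R transport t B A"
    unfolding K1_def resolvent_conj [OF sqrt_conj_psd(1) t]
    by (simp add: mat_ring psd_sqrt_square transport_alt C_def K1_def)
  finally show ?thesis by (simp add: mat_ring)
qed

end

section \<open>The principal square root and the potentials U and V\<close>

text \<open>The entrywise embedding of real into complex matrices, as used in the notion of positive spectrum.\<close>

abbreviation complexify :: "real^'n^'m \<Rightarrow> complex^'n^'m" where
  "complexify \<equiv> map_matrix complex_of_real"

lemma complexify_mult: "complexify (X ** Y) = complexify X ** complexify (Y :: real^'n^'n)"
  by (simp add: map_matrix_def matrix_matrix_mult_def vec_eq_iff)

lemma complexify_add: "complexify (X + Y) = complexify X + complexify (Y :: real^'n^'n)"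
  by (simp add: map_matrix_def vec_eq_iff)

lemma complexify_scaleR_1: "complexify (c *\<^sub>R mat 1) *v v = complex_of_real c *s (v :: complex^'n)"
  by (simp add: map_matrix_def vec_eq_iff matrix_vector_mult_def mat_def if_distrib [of "\<lambda>x. _ * x"]
      if_distrib [of "\<lambda>x. x * _"] if_distrib [of complex_of_real] cong: if_cong)

lemma complexify_diag: "(complexify (diag_matrix s) *v v) $ i = complex_of_real (s $ i) * v $ i"
  by (simp add: map_matrix_def matrix_vector_mult_def diag_matrix_def if_distrib [of "\<lambda>x. x * _"]
      if_distrib [of complex_of_real] cong: if_cong)

lemma positive_spectrum_no_neg:
  fixes y :: "real^'n"
  assumes R: "positive_spectrum R" and y: "R *v y = - c *\<^sub>R y" and c: "0 < c"
  shows "y = 0"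
proof (rule ccontr)
  assume "y \<noteq> 0"
  define v where "v = (\<chi> i. complex_of_real (y $ i))"
  have "v \<noteq> 0" using \<open>y \<noteq> 0\<close> by (simp add: v_def vec_eq_iff)
  moreover have "(complexify R *v v) $ i = complex_of_real ((R *v y) $ i)" for i
    by (simp add: v_def map_matrix_def matrix_vector_mult_def)
  then have "complexify R *v v = complex_of_real (- c) *s v"
    by (simp add: y v_def vec_eq_iff)
  ultimately have "0 < Re (complex_of_real (- c))"
    using R unfolding positive_spectrum_def by blast
  then show False using c by simp
qed

lemma positive_spectrum_no_neg_mat:
  fixes Y :: "real^'n^'n"
  assumes R: "positive_spectrum R" and Y: "R ** Y = - (Y ** diag_matrix s)" and s: "\<And>i. 0 < s $ i"
  shows "Y = 0"
proof -
  have "column j Y = 0" for j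
  proof (rule positive_spectrum_no_neg [OF R _ s])
    have "column j (R ** Y) = column j (- (Y ** diag_matrix s))" by (simp add: Y)
    then show "R *v column j Y = - (s $ j) *\<^sub>R column j Y"
      by (simp add: column_def matrix_vector_mult_def matrix_matrix_mult_def vec_eq_iff
          diag_matrix_def if_distrib [of "\<lambda>x. _ * x"] mult.commute cong: if_cong)
  qed
  then show ?thesis by (simp add: column_def vec_eq_iff)
qed

text \<open>Both parts use an orthonormal eigenbasis \<open>V\<close> of \<open>S = S(a B a)\<close>. The candidate root \<open>R\<^sub>0\<close> satisfies
  \<open>R\<^sub>0 a = a S\<close> and \<open>(a B) R\<^sub>0 = S (a B)\<close>, so its eigenvalues are \<open>t/2\<close> or eigenvalues of \<open>S\<close>. It need not be
  symmetric, and \<open>a V\<close> need not be invertible.\<close>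

lemma principal_sqrt_product:
  fixes A B :: "real^'n^'n"
  assumes t: "0 < t" and A: "A \<in> psd_matrices" and B: "B \<in> psd_matrices"
  defines "R0 \<equiv> transport t B A ** B + (t / 2) *\<^sub>R mat 1"
  shows positive_spectrum_root: "positive_spectrum R0"
    and principal_sqrt_eq: "principal_sqrt (A ** B + (t\<^sup>2 / 4) *\<^sub>R mat 1) = R0"
proof -
  define a where "a = psd_sqrt A"
  define M where "M = a ** B ** a"
  define S where "S = shifted_root t M"
  define K where "K = resolvent t M"
  define C where "C = transport t B A ** B"
  have M: "M \<in> psd_matrices" using sqrt_conj_psd(1) [OF t A B] by (simp add: M_def a_def)
  have Ca: "C ** a = a ** (S - (t / 2) *\<^sub>R mat 1)"
    using C_mult_sqrt [OF t A B] by (simp add: a_def M_def S_def C_def)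
  have aBC: "a ** B ** C = (S - (t / 2) *\<^sub>R mat 1) ** (a ** B)"
    using sqrt_mult_C [OF t A B] by (simp add: a_def M_def S_def C_def)
  have CK: "C = a ** K ** (a ** B)"
    by (simp add: C_def transport_def K_def M_def a_def matrix_mul_assoc)
  have R0C: "R0 = C + (t / 2) *\<^sub>R mat 1" by (simp add: R0_def C_def)
  obtain V s where V: "orthogonal_matrix V" and Ss: "S = V ** diag_matrix s ** transpose V"
    using symmetric_diagonalization [OF psd_sym [OF shifted_root_psd [OF M, of t]]] unfolding S_def by metis
  have s: "0 < s $ i" for i
  proof -
    have "S \<in> pd_matrices"
      using pd_add_psd [OF pd_scaleR [OF pd_mat_1] shifted_root_ge [OF M t], of "t/2"] t
      by (simp add: S_def)
    then show ?thesis using pd_diag_pos [OF _ V] unfolding Ss by blast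
  qed
  have VtV: "transpose V ** V = mat 1" "V ** transpose V = mat 1"
    using V by (auto simp: orthogonal_matrix_def)
  show pos: "positive_spectrum R0"
    unfolding positive_spectrum_def
  proof (intro allI impI)
    fix c :: complex and v :: "complex^'n"
    assume v: "v \<noteq> 0 \<and> complexify R0 *v v = c *s v"
    define L where "L = transpose V ** (a ** B)"
    have aB: "a ** B = V ** L" by (simp add: L_def matrix_mul_assoc VtV)
    have "L ** R0 = diag_matrix s ** L"
    proof -
      have "L ** R0 = transpose V ** (a ** B ** C + (t / 2) *\<^sub>R (a ** B))"
        by (simp add: L_def R0C mat_ring)
      also have "\<dots> = transpose V ** (S ** (a ** B))"
        unfolding aBC by (simp add: mat_ring)
      also have "\<dots> = (transpose V ** V) ** diag_matrix s ** L"
        by (simp add: Ss L_def matrix_mul_assoc)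
      finally show ?thesis by (simp add: VtV)
    qed
    then have LR: "complexify L ** complexify R0 = complexify (diag_matrix s) ** complexify L"
      by (metis complexify_mult)
    define u where "u = complexify L *v v"
    have "complexify (diag_matrix s) *v u = (complexify L ** complexify R0) *v v"
      by (simp add: u_def LR matrix_vector_mul_assoc)
    also have "\<dots> = c *s u"
      using v by (simp add: u_def matrix_vector_mul_assoc [symmetric] vector_scalar_commute)
    finally have eig: "complex_of_real (s $ i) * u $ i = c * u $ i" for i
      by (metis complexify_diag vector_smult_component)
    show "c \<in> \<real> \<and> 0 < Re c"
    proof (cases "u = 0")
      case False
      then obtain i where "u $ i \<noteq> 0" by (auto simp: vec_eq_iff)
      then have "c = complex_of_real (s $ i)" using eig [of i] by simp
      then show ?thesis using s by simp
    next
      case True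
      have "C = (a ** K ** V) ** L" unfolding CK aB by (simp add: matrix_mul_assoc)
      then have "complexify C *v v = complexify (a ** K ** V) *v u"
        by (simp add: u_def complexify_mult matrix_vector_mul_assoc)
      then have "complexify R0 *v v = complex_of_real (t / 2) *s v"
        using True by (simp add: R0C complexify_add matrix_vector_mult_add_rdistrib complexify_scaleR_1)
      then have "(c - complex_of_real (t / 2)) *s v = 0"
        using v by (simp add: vector_sub_rdistrib)
      then have "c = complex_of_real (t / 2)" using v by simp
      then show ?thesis using t by (simp del: of_real_divide)
    qed
  qed
  show "principal_sqrt (A ** B + (t\<^sup>2 / 4) *\<^sub>R mat 1) = R0"
    unfolding principal_sqrt_def
  proof (rule the_equality)
    have RR: "R0 ** R0 = A ** B + (t\<^sup>2 / 4) *\<^sub>R mat 1"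
      unfolding R0_def by (rule root_C_sq [OF t A B])
    show "R0 ** R0 = A ** B + (t\<^sup>2 / 4) *\<^sub>R mat 1 \<and> positive_spectrum R0"
      using RR pos by blast
    fix R :: "real^'n^'n"
    assume R: "R ** R = A ** B + (t\<^sup>2 / 4) *\<^sub>R mat 1 \<and> positive_spectrum R"
    define X where "X = R - R0"
    \<comment> \<open>The two roots anticommute through their difference, so an eigenvector of R0 for a positive
      eigenvalue is mapped by X to an eigenvector of R for a negative eigenvalue, that is to 0.\<close>
    have RX: "R ** X = - (X ** R0)"
      using R RR by (simp add: X_def mat_ring)
    have R0aV: "R0 ** (a ** V) = (a ** V) ** diag_matrix s"
    proof -
      have "R0 ** (a ** V) = (C ** a + (t / 2) *\<^sub>R a) ** V" by (simp add: R0C mat_ring)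
      also have "\<dots> = a ** S ** V" unfolding Ca by (simp add: mat_ring)
      also have "\<dots> = a ** V ** diag_matrix s ** (transpose V ** V)" by (simp add: Ss matrix_mul_assoc)
      finally show ?thesis by (simp add: VtV matrix_mul_assoc)
    qed
    have "X ** (a ** V) = 0"
    proof (rule positive_spectrum_no_neg_mat [where s = s])
      show "R ** (X ** (a ** V)) = - (X ** (a ** V) ** diag_matrix s)"
        using RX R0aV by (metis matrix_minus_left matrix_mul_assoc)
    qed (use R s in auto)
    then have "X ** (a ** V) ** transpose V = 0" by (simp add: matrix_zero_left)
    then have "X ** a ** (V ** transpose V) = 0" by (simp add: matrix_mul_assoc)
    then have "X ** a = 0" by (simp add: VtV)
    then have "X ** C = 0" by (simp add: CK matrix_mul_assoc matrix_zero_left)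
    then have "X ** R0 = (t / 2) *\<^sub>R X" by (simp add: R0C mat_ring)
    then have "R ** X = - (X ** diag_matrix (\<chi> i. t / 2))"
      unfolding RX
      by (simp add: vec_eq_iff matrix_matrix_mult_def diag_matrix_def if_distrib [of "\<lambda>x. _ * x"]
          mult.commute cong: if_cong)
    then have "X = 0"
      by (rule positive_spectrum_no_neg_mat [rotated]) (use R t in auto)
    then show "R = R0" by (simp add: X_def)
  qed
qed

lemma C_mat_eq:
  assumes "0 < \<sigma>" "A \<in> psd_matrices" "B \<in> psd_matrices"
  shows "C_mat \<sigma> A B = transport (\<sigma>\<^sup>2) B A ** B"
  using principal_sqrt_eq [of "\<sigma>\<^sup>2" A B] assms
  by (simp add: C_mat_def power_mult [symmetric])

lemma UV_mat_eq:
  fixes A B :: "real^'n^'n"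
  assumes \<sigma>: "0 < \<sigma>" and A: "A \<in> psd_matrices" and B: "B \<in> psd_matrices"
  shows "- (\<sigma>\<^sup>2 *\<^sub>R U_mat \<sigma> A B) = mat 1 - transport (\<sigma>\<^sup>2) A B"
    and "- (\<sigma>\<^sup>2 *\<^sub>R V_mat \<sigma> A B) = mat 1 - transport (\<sigma>\<^sup>2) B A"
proof -
  have t: "0 < \<sigma>\<^sup>2" using \<sigma> by simp
  define C where "C = transport (\<sigma>\<^sup>2) B A ** B"
  define W where "W = C + \<sigma>\<^sup>2 *\<^sub>R mat 1"
  have W: "W ** matrix_inv W = mat 1" "matrix_inv W ** W = mat 1"
  proof -
    have "x = 0" if "W *v x = 0" for x
    proof (rule positive_spectrum_no_neg [OF positive_spectrum_root [OF t A B]])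
      have "C *v x = - (\<sigma>\<^sup>2 *\<^sub>R x)"
        using that unfolding W_def matrix_vector_mult_add_rdistrib scaleR_vector
        by (simp add: add_eq_0_iff)
      then show "(transport (\<sigma>\<^sup>2) B A ** B + (\<sigma>\<^sup>2 / 2) *\<^sub>R mat 1) *v x = - (\<sigma>\<^sup>2 / 2) *\<^sub>R x"
        unfolding C_def [symmetric] matrix_vector_mult_add_rdistrib scaleR_vector
        by (simp add: vec_eq_iff)
    qed (use t in simp)
    then show "W ** matrix_inv W = mat 1" "matrix_inv W ** W = mat 1"
      using matrix_inv_if_trivial_kernel by blast+
  qed
  have "transport (\<sigma>\<^sup>2) A B ** W ** matrix_inv W = B ** matrix_inv W"
    using transport_mult_C [OF t A B] by (simp add: W_def C_def)
  then have "B ** matrix_inv W = transport (\<sigma>\<^sup>2) A B"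
    by (simp add: W flip: matrix_mul_assoc)
  then show "- (\<sigma>\<^sup>2 *\<^sub>R U_mat \<sigma> A B) = mat 1 - transport (\<sigma>\<^sup>2) A B"
    using \<sigma> by (simp add: U_mat_def C_mat_eq [OF assms] W_def C_def scaleR_diff_right)
  have "matrix_inv W ** (W ** transport (\<sigma>\<^sup>2) B A) = matrix_inv W ** A"
    using C_mult_transport [OF t A B] by (simp add: W_def C_def)
  then have "matrix_inv W ** A = transport (\<sigma>\<^sup>2) B A"
    by (simp add: W matrix_mul_assoc)
  then show "- (\<sigma>\<^sup>2 *\<^sub>R V_mat \<sigma> A B) = mat 1 - transport (\<sigma>\<^sup>2) B A"
    using \<sigma> by (simp add: V_mat_def C_mat_eq [OF assms] W_def C_def scaleR_diff_right)
qed

section \<open>The entropic cost through the spectral function\<close>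

lemma transport_psd:
  assumes "0 < t" "A \<in> psd_matrices" "B \<in> psd_matrices"
  shows "transport t A B \<in> psd_matrices"
  unfolding transport_def
  by (intro psd_conj_sym resolvent_psd psd_sym psd_sqrt assms)

lemma entropic_bures_eq:
  fixes A B :: "real^'n^'n"
  assumes \<sigma>: "0 < \<sigma>" and A: "A \<in> psd_matrices" and B: "B \<in> psd_matrices"
  shows "entropic_bures \<sigma> A B = mat 1 \<bullet> A + mat 1 \<bullet> B
    + bures_spectral (\<sigma>\<^sup>2) (psd_sqrt A ** B ** psd_sqrt A) + real CARD('n) * \<sigma>\<^sup>2 * (1 - ln (\<sigma>\<^sup>2))"
proof -
  define t where "t = \<sigma>\<^sup>2"
  have t: "0 < t" using \<sigma> by (simp add: t_def)
  define M where "M = psd_sqrt A ** B ** psd_sqrt A"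
  define S where "S = shifted_root t M"
  have M: "M \<in> psd_matrices" using sqrt_conj_psd(1) [OF t A B] by (simp add: M_def)
  have t4: "\<sigma>^4 = t\<^sup>2" by (simp add: t_def power_mult [symmetric])
  have D: "D_mat \<sigma> A B = 2 *\<^sub>R S"
    unfolding D_mat_def t4
  proof (rule psd_sqrt_eqI)
    show "2 *\<^sub>R S \<in> psd_matrices"
      unfolding S_def by (intro psd_scaleR shifted_root_psd M) simp
    show "2 *\<^sub>R S ** 2 *\<^sub>R S = 4 *\<^sub>R (psd_sqrt A ** B ** psd_sqrt A) + t\<^sup>2 *\<^sub>R mat 1"
      unfolding M_def [symmetric]
      by (simp add: S_def mat_ring shifted_root_sq [OF M] scaleR_add_right)
  qed
  have "D_mat \<sigma> A B + \<sigma>\<^sup>2 *\<^sub>R mat 1 = 2 *\<^sub>R (S + (t / 2) *\<^sub>R mat 1)"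
    by (simp add: D t_def scaleR_add_right)
  then have "det (D_mat \<sigma> A B + \<sigma>\<^sup>2 *\<^sub>R mat 1) = 2 ^ CARD('n) * det (S + (t / 2) *\<^sub>R mat 1)"
    by (simp add: det_scaleR)
  then have "ln (det (D_mat \<sigma> A B + \<sigma>\<^sup>2 *\<^sub>R mat 1))
      = real CARD('n) * ln 2 + ln (det (S + (t / 2) *\<^sub>R mat 1))"
    using pd_det_pos [OF shifted_root_plus_pd [OF M t]]
    by (simp add: S_def ln_mult ln_realpow)
  moreover have "ln (2 * \<sigma>\<^sup>2) = ln 2 + ln t" using t by (simp add: t_def ln_mult)
  ultimately show ?thesis
    unfolding entropic_bures_def D trace_inner
    by (simp add: bures_spectral_def t_def [symmetric] M_def [symmetric] S_def [symmetric] algebra_simps)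
qed

lemma entropic_bures_sym:
  assumes "0 < \<sigma>" "A \<in> psd_matrices" "B \<in> psd_matrices"
  shows "entropic_bures \<sigma> A B = entropic_bures \<sigma> B A"
  using bures_spectral_sym [of "\<sigma>\<^sup>2" A B] assms by (simp add: entropic_bures_eq)

text \<open>By symmetry of the cost, the expression \<open>H(b A b)\<close> may be used. Unlike \<open>H(a B a)\<close>, its inner matrix is
  linear in \<open>A\<close>.\<close>

lemma entropic_bures_tangent:
  fixes A B :: "real^'n^'n"
  assumes \<sigma>: "0 < \<sigma>" and A: "A \<in> psd_matrices" and X: "X \<in> psd_matrices" and B: "B \<in> psd_matrices"
  shows "entropic_bures \<sigma> A B + (mat 1 - transport (\<sigma>\<^sup>2) A B) \<bullet> (X - A) \<le> entropic_bures \<sigma> X B"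
proof -
  define t where "t = \<sigma>\<^sup>2"
  have t: "0 < t" using \<sigma> by (simp add: t_def)
  define b where "b = psd_sqrt B"
  have b: "b \<in> sym_matrices" using psd_sqrt(1) [OF B] psd_sym by (simp add: b_def)
  have "bures_spectral t (b ** A ** b) - resolvent t (b ** A ** b) \<bullet> (b ** X ** b - b ** A ** b)
      \<le> bures_spectral t (b ** X ** b)"
    by (intro bures_spectral_tangent psd_conj_sym A X b t)
  moreover have "resolvent t (b ** A ** b) \<bullet> (b ** X ** b - b ** A ** b) = transport t A B \<bullet> (X - A)"
  proof -
    have "b ** X ** b - b ** A ** b = b ** (X - A) ** b" by (simp add: mat_ring)
    then show ?thesis
      unfolding transport_def b_def [symmetric]
      by (simp add: inner_sym_right [OF b] inner_sym_left [OF b] matrix_mul_assoc)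
  qed
  ultimately show ?thesis
    unfolding entropic_bures_sym [OF \<sigma> A B] entropic_bures_sym [OF \<sigma> X B]
      entropic_bures_eq [OF \<sigma> B A] entropic_bures_eq [OF \<sigma> B X]
    by (simp add: t_def b_def inner_diff_left inner_diff_right)
qed

lemma convex_on_tangentI:
  fixes f :: "'a::real_inner \<Rightarrow> real"
  assumes S: "convex S" and g: "\<And>x y. x \<in> S \<Longrightarrow> y \<in> S \<Longrightarrow> f x + g x \<bullet> (y - x) \<le> f y"
  shows "convex_on S f"
proof (rule convex_onI [OF _ S])
  fix u :: real and x y assume u: "0 < u" "u < 1" and xy: "x \<in> S" "y \<in> S"
  define z where "z = (1 - u) *\<^sub>R x + u *\<^sub>R y"
  have z: "z \<in> S" using S xy u by (simp add: z_def convexD_alt)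
  have "(1 - u) * (f z + g z \<bullet> (x - z)) + u * (f z + g z \<bullet> (y - z)) \<le> (1 - u) * f x + u * f y"
    using u g [OF z xy(1)] g [OF z xy(2)] by (intro add_mono mult_left_mono) auto
  moreover have "(1 - u) * (f z + g z \<bullet> (x - z)) + u * (f z + g z \<bullet> (y - z))
      = f z + g z \<bullet> ((1 - u) *\<^sub>R (x - z) + u *\<^sub>R (y - z))"
    by (simp add: inner_add_right algebra_simps)
  moreover have "(1 - u) *\<^sub>R (x - z) + u *\<^sub>R (y - z) = 0"
    by (simp add: z_def algebra_simps)
  ultimately show "f z \<le> (1 - u) * f x + u * f y" by simp
qed

section \<open>Continuity and gradients\<close>

text \<open>Since the identity has Frobenius norm \<open>sqrt n\<close>, a matrix between 0 and \<open>Id/t\<close> has norm at most \<open>sqrt n / t\<close>.\<close>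

lemma psd_norm_le:
  fixes K :: "real^'n^'n"
  assumes K: "K \<in> psd_matrices" and t: "0 < t" and le: "mat 1 - t *\<^sub>R K \<in> psd_matrices"
  shows "norm K \<le> sqrt CARD('n) / t"
proof -
  have "0 \<le> K \<bullet> (mat 1 - t *\<^sub>R K)" by (rule psd_inner_nonneg [OF K le])
  then have "t * (norm K)\<^sup>2 \<le> K \<bullet> mat 1" by (simp add: inner_diff_right power2_norm_eq_inner)
  also have "\<dots> \<le> norm K * norm (mat 1 :: real^'n^'n)" by (rule norm_cauchy_schwarz)
  also have "norm (mat 1 :: real^'n^'n) = sqrt CARD('n)" by (simp add: norm_eq_sqrt_inner inner_mat_1)
  finally have "norm K * (t * norm K) \<le> norm K * sqrt CARD('n)" by (simp add: power2_eq_square mult_ac)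
  then have "t * norm K \<le> sqrt CARD('n)"
    by (cases "K = 0") (auto simp: mult_le_cancel_left)
  then show ?thesis using t by (simp add: field_simps)
qed

lemma continuous_on_psd_sqrt: "continuous_on (psd_matrices :: (real^'n^'n) set) psd_sqrt"
  unfolding continuous_on_iff
proof (intro ballI allI impI)
  fix A :: "real^'n^'n" and e :: real assume A: "A \<in> psd_matrices" and e: "0 < e"
  have d: "0 < e\<^sup>2 / real CARD('n)" using e by simp
  show "\<exists>d>0. \<forall>X\<in>psd_matrices. dist X A < d \<longrightarrow> dist (psd_sqrt X) (psd_sqrt A) < e"
  proof (intro exI [of _ "e\<^sup>2 / real CARD('n)"] conjI d ballI impI)
    fix X :: "real^'n^'n" assume X: "X \<in> psd_matrices" and lt: "dist X A < e\<^sup>2 / real CARD('n)"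
    have "(norm (psd_sqrt X - psd_sqrt A))\<^sup>2 \<le> real CARD('n) * norm (X - A)"
      using psd_root_dist [OF psd_sqrt(1) psd_sqrt(1), OF X A] by (simp add: psd_sqrt(2) X A)
    also have "\<dots> < e\<^sup>2" using lt by (simp add: dist_norm field_simps)
    finally show "dist (psd_sqrt X) (psd_sqrt A) < e"
      using e by (simp add: dist_norm power2_less_imp_less)
  qed
qed

lemma continuous_on_resolvent:
  assumes t: "0 < t"
  shows "continuous_on (psd_matrices :: (real^'n^'n) set) (resolvent t)"
  unfolding continuous_on_def
proof (intro ballI)
  fix A :: "real^'n^'n" assume A: "A \<in> psd_matrices"
  let ?F = "at A within psd_matrices" and ?c = "(sqrt CARD('n) / t)\<^sup>2"
  have "continuous_on (psd_matrices :: (real^'n^'n) set) (shifted_root t)"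
    unfolding shifted_root_def
    by (rule continuous_on_compose2 [OF continuous_on_psd_sqrt]) (auto intro!: continuous_intros shifted_psd)
  then have "(shifted_root t \<longlongrightarrow> shifted_root t A) ?F"
    using A by (simp add: continuous_on_def)
  then have "((\<lambda>X. ?c * norm (shifted_root t A - shifted_root t X)) \<longlongrightarrow> ?c * norm (shifted_root t A - shifted_root t A)) ?F"
    by (intro tendsto_intros)
  then have lim: "((\<lambda>X. ?c * norm (shifted_root t A - shifted_root t X)) \<longlongrightarrow> 0) ?F" by simp
  have "norm (resolvent t X - resolvent t A) \<le> ?c * norm (shifted_root t A - shifted_root t X)"
    if X: "X \<in> psd_matrices" for X
  proof -
    let ?T = "\<lambda>X. shifted_root t X + (t / 2) *\<^sub>R mat 1"
    have "resolvent t X - resolvent t A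
        = resolvent t X ** (?T A ** resolvent t A) - (resolvent t X ** ?T X) ** resolvent t A"
      by (simp add: resolvent_inverse A X t)
    also have "\<dots> = resolvent t X ** (?T A - ?T X) ** resolvent t A"
      by (simp only: mat_ring)
    also have "?T A - ?T X = shifted_root t A - shifted_root t X" by simp
    finally have "norm (resolvent t X - resolvent t A)
        \<le> norm (resolvent t X ** (shifted_root t A - shifted_root t X)) * norm (resolvent t A)"
      by (simp only: norm_matrix_mult)
    also have "\<dots> \<le> norm (resolvent t X) * norm (shifted_root t A - shifted_root t X) * norm (resolvent t A)"
      by (intro mult_right_mono norm_matrix_mult norm_ge_zero)
    also have "\<dots> \<le> (sqrt CARD('n) / t) * norm (shifted_root t A - shifted_root t X) * (sqrt CARD('n) / t)"
      using psd_norm_le [OF resolvent_psd [OF X t] t resolvent_le [OF X t]]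
        psd_norm_le [OF resolvent_psd [OF A t] t resolvent_le [OF A t]] t
      by (intro mult_mono) auto
    finally show ?thesis by (simp only: power2_eq_square mult_ac)
  qed
  then have "eventually (\<lambda>X. norm (resolvent t X - resolvent t A) \<le> ?c * norm (shifted_root t A - shifted_root t X)) ?F"
    by (auto simp: eventually_at_filter)
  then have "((\<lambda>X. resolvent t X - resolvent t A) \<longlongrightarrow> 0) ?F"
    using lim by (rule Lim_null_comparison)
  then show "(resolvent t \<longlongrightarrow> resolvent t A) ?F" by (simp add: LIM_zero_iff)
qed

lemma continuous_on_matrix_mult:
  "continuous_on S f \<Longrightarrow> continuous_on S g \<Longrightarrow> continuous_on S (\<lambda>x. f x ** (g x :: real^'n^'n))"
  by (rule bounded_bilinear.continuous_on [OF bounded_bilinear_matrix_mult])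

lemma continuous_on_transport:
  assumes t: "0 < t"
  shows "continuous_on ((psd_matrices :: (real^'n^'n) set) \<times> psd_matrices) (\<lambda>p. transport t (fst p) (snd p))"
proof -
  let ?D = "(psd_matrices :: (real^'n^'n) set) \<times> psd_matrices"
  have b: "continuous_on ?D (\<lambda>p. psd_sqrt (snd p))"
    by (rule continuous_on_compose2 [OF continuous_on_psd_sqrt]) (auto intro!: continuous_intros)
  have "continuous_on ?D (\<lambda>p. psd_sqrt (snd p) ** fst p ** psd_sqrt (snd p))"
    by (intro continuous_on_matrix_mult b continuous_intros)
  then have "continuous_on ?D (\<lambda>p. resolvent t (psd_sqrt (snd p) ** fst p ** psd_sqrt (snd p)))"
    by (rule continuous_on_compose2 [OF continuous_on_resolvent [OF t]])
      (auto intro!: psd_conj_sym psd_sym psd_sqrt)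
  then show ?thesis unfolding transport_def
    by (intro continuous_on_matrix_mult b)
qed

lemma has_derivative_squeeze:
  fixes f :: "'a::real_inner \<Rightarrow> real"
  assumes e: "(e \<longlongrightarrow> 0) (at x within S)"
    and le: "\<And>y. y \<in> S \<Longrightarrow> \<bar>f y - f x - g \<bullet> (y - x)\<bar> \<le> e y * norm (y - x)"
  shows "(f has_derivative (\<lambda>h. g \<bullet> h)) (at x within S)"
  unfolding has_derivative_within
proof
  show "bounded_linear (\<lambda>h. g \<bullet> h)" by (rule bounded_linear_inner_right)
  have "norm ((1 / norm (y - x)) *\<^sub>R (f y - (f x + g \<bullet> (y - x)))) \<le> e y" if "y \<in> S" "y \<noteq> x" for y
    using le [OF that(1)] that(2) by (simp add: field_simps)
  then have "eventually (\<lambda>y. norm ((1 / norm (y - x)) *\<^sub>R (f y - (f x + g \<bullet> (y - x)))) \<le> e y) (at x within S)"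
    by (auto simp: eventually_at_filter)
  then show "((\<lambda>y. (1 / norm (y - x)) *\<^sub>R (f y - (f x + g \<bullet> (y - x)))) \<longlongrightarrow> 0) (at x within S)"
    using e by (rule Lim_null_comparison)
qed

text \<open>The tangent inequalities at \<open>A\<close> and at \<open>X\<close> bound the increment from both sides. The reference slope
  is left arbitrary because the second argument also varies where this is applied.\<close>

lemma entropic_bures_partial_bound:
  fixes A B :: "real^'n^'n"
  assumes "0 < \<sigma>" "A \<in> psd_matrices" "X \<in> psd_matrices" "B \<in> psd_matrices"
  shows "\<bar>entropic_bures \<sigma> X B - entropic_bures \<sigma> A B - (mat 1 - G) \<bullet> (X - A)\<bar>
    \<le> (norm (transport (\<sigma>\<^sup>2) A B - G) + norm (transport (\<sigma>\<^sup>2) X B - G)) * norm (X - A)"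
proof -
  let ?f = "\<lambda>X. entropic_bures \<sigma> X B" and ?G = "\<lambda>X. transport (\<sigma>\<^sup>2) X B"
  have "?f A + (mat 1 - ?G A) \<bullet> (X - A) \<le> ?f X" "?f X + (mat 1 - ?G X) \<bullet> (A - X) \<le> ?f A"
    using entropic_bures_tangent assms by blast+
  moreover have "\<bar>(?G A - G) \<bullet> (X - A)\<bar> \<le> norm (?G A - G) * norm (X - A)"
    "\<bar>(?G X - G) \<bullet> (X - A)\<bar> \<le> norm (?G X - G) * norm (X - A)"
    by (rule Cauchy_Schwarz_ineq2)+
  ultimately show ?thesis
    by (simp add: inner_diff_left inner_diff_right algebra_simps abs_le_iff)
qed

lemma entropic_bures_gradient:
  fixes A B :: "real^'n^'n"
  assumes \<sigma>: "0 < \<sigma>" and A: "A \<in> psd_matrices" and B: "B \<in> psd_matrices"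
  shows "((\<lambda>(X, Y). entropic_bures \<sigma> X Y) has_derivative
    (\<lambda>h. (mat 1 - transport (\<sigma>\<^sup>2) A B, mat 1 - transport (\<sigma>\<^sup>2) B A) \<bullet> h))
    (at (A, B) within psd_matrices \<times> psd_matrices)"
proof -
  define t where "t = \<sigma>\<^sup>2"
  have t: "0 < t" using \<sigma> by (simp add: t_def)
  let ?D = "(psd_matrices :: (real^'n^'n) set) \<times> psd_matrices"
  let ?F = "at (A, B) within ?D"
  define e1 where "e1 = (\<lambda>p. norm (transport t A (snd p) - transport t A B)
    + norm (transport t (fst p) (snd p) - transport t A B))"
  define e2 where "e2 = (\<lambda>p::(real^'n^'n) \<times> (real^'n^'n). norm (transport t B A - transport t B A)
    + norm (transport t (snd p) A - transport t B A))"
  have tr: "continuous_on ?D (\<lambda>p. transport t (f p) (g p))"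
    if "continuous_on ?D f" "continuous_on ?D g" "\<And>p. p \<in> ?D \<Longrightarrow> f p \<in> psd_matrices \<and> g p \<in> psd_matrices"
    for f g :: "(real^'n^'n) \<times> (real^'n^'n) \<Rightarrow> real^'n^'n"
    using continuous_on_compose2 [OF continuous_on_transport [OF t], of ?D "\<lambda>p. (f p, g p)"] that
    by (force intro!: continuous_intros)
  have "continuous_on ?D (\<lambda>p. e1 p + e2 p)"
    unfolding e1_def e2_def by (intro continuous_intros tr) (auto simp: A)
  then have "((\<lambda>p. e1 p + e2 p) \<longlongrightarrow> e1 (A, B) + e2 (A, B)) ?F"
    using A B by (auto simp: continuous_on_def)
  then have lim: "((\<lambda>p. e1 p + e2 p) \<longlongrightarrow> 0) ?F" by (simp add: e1_def e2_def)
  show ?thesis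
  \<comment> \<open>The increment is split at the intermediate point (A, Y), which lies in the domain again.\<close>
  proof (rule has_derivative_squeeze [OF lim])
    fix p :: "(real^'n^'n) \<times> (real^'n^'n)" assume "p \<in> ?D"
    then obtain X Y where p: "p = (X, Y)" and X: "X \<in> psd_matrices" and Y: "Y \<in> psd_matrices"
      by auto
    have 1: "\<bar>entropic_bures \<sigma> X Y - entropic_bures \<sigma> A Y - (mat 1 - transport t A B) \<bullet> (X - A)\<bar>
        \<le> e1 p * norm (X - A)"
      using entropic_bures_partial_bound [OF \<sigma> A X Y, of "transport t A B"] by (simp add: e1_def p t_def)
    have 2: "\<bar>entropic_bures \<sigma> A Y - entropic_bures \<sigma> A B - (mat 1 - transport t B A) \<bullet> (Y - B)\<bar>
        \<le> e2 p * norm (Y - B)"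
      using entropic_bures_partial_bound [OF \<sigma> B Y A, of "transport t B A"]
      by (simp add: e2_def p t_def entropic_bures_sym [OF \<sigma> A Y] entropic_bures_sym [OF \<sigma> A B])
    have "norm (X - A) \<le> norm (p - (A, B))" "norm (Y - B) \<le> norm (p - (A, B))"
      using norm_fst_le [of "X - A" "Y - B"] norm_snd_le [of "Y - B" "X - A"] by (simp_all add: p)
    moreover have "0 \<le> e1 p" "0 \<le> e2 p" by (simp_all add: e1_def e2_def)
    ultimately have "e1 p * norm (X - A) \<le> e1 p * norm (p - (A, B))" "e2 p * norm (Y - B) \<le> e2 p * norm (p - (A, B))"
      by (auto intro: mult_left_mono)
    with 1 2 show "\<bar>(case p of (X, Y) \<Rightarrow> entropic_bures \<sigma> X Y) - (case (A, B) of (X, Y) \<Rightarrow> entropic_bures \<sigma> X Y)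
        - (mat 1 - transport (\<sigma>\<^sup>2) A B, mat 1 - transport (\<sigma>\<^sup>2) B A) \<bullet> (p - (A, B))\<bar>
        \<le> (e1 p + e2 p) * norm (p - (A, B))"
      by (simp add: p t_def [symmetric] inner_Pair distrib_right abs_le_iff)
  qed
qed

lemma entropic_bures_partial_gradient:
  fixes A B :: "real^'n^'n"
  assumes \<sigma>: "0 < \<sigma>" and A: "A \<in> psd_matrices" and B: "B \<in> psd_matrices"
  shows "((\<lambda>X. entropic_bures \<sigma> X B) has_derivative (\<lambda>h. (mat 1 - transport (\<sigma>\<^sup>2) A B) \<bullet> h))
    (at A within psd_matrices)"
proof -
  have *: "((\<lambda>X. (X, B)) has_derivative (\<lambda>h. (h, 0))) (at A within psd_matrices)"
    by (auto intro!: derivative_eq_intros)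
  have "((\<lambda>(X, Y). entropic_bures \<sigma> X Y) has_derivative
    (\<lambda>h. (mat 1 - transport (\<sigma>\<^sup>2) A B, mat 1 - transport (\<sigma>\<^sup>2) B A) \<bullet> h))
    (at (A, B) within (\<lambda>X. (X, B)) ` psd_matrices)"
    by (rule has_derivative_subset [OF entropic_bures_gradient [OF assms]]) (use B in auto)
  from has_derivative_in_compose [OF * this] show ?thesis by (simp add: inner_Pair)
qed

section \<open>Failure of joint convexity\<close>

lemma psd_sqrt_scalar:
  assumes "0 \<le> c" shows "psd_sqrt (c *\<^sub>R mat 1 :: real^'n^'n) = sqrt c *\<^sub>R mat 1"
proof (rule psd_sqrt_eqI)
  show "sqrt c *\<^sub>R mat 1 \<in> (psd_matrices :: (real^'n^'n) set)"
    using assms by (intro psd_scaleR psd_mat_1) simp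
  show "sqrt c *\<^sub>R mat 1 ** sqrt c *\<^sub>R mat 1 = (c *\<^sub>R mat 1 :: real^'n^'n)"
    using assms by (simp add: mat_ring)
qed

lemma entropic_bures_scalar:
  fixes \<sigma> r d :: real
  assumes \<sigma>: "0 < \<sigma>" and r: "0 \<le> r" and d: "0 < d" and eq: "4 * r\<^sup>2 + (\<sigma>\<^sup>2)\<^sup>2 = d\<^sup>2"
  shows "entropic_bures \<sigma> (r *\<^sub>R mat 1 :: real^'n^'n) (r *\<^sub>R mat 1)
    = real CARD('n) * (2 * r - d + \<sigma>\<^sup>2 * (1 - ln (2 * \<sigma>\<^sup>2)) + \<sigma>\<^sup>2 * ln (d + \<sigma>\<^sup>2))"
proof -
  have "D_mat \<sigma> (r *\<^sub>R mat 1 :: real^'n^'n) (r *\<^sub>R mat 1) = psd_sqrt (d\<^sup>2 *\<^sub>R mat 1)"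
    using r unfolding D_mat_def psd_sqrt_scalar [OF r] eq [symmetric]
    by (simp add: mat_ring power2_eq_square scaleR_add_left numeral_eq_Suc mult_ac)
  also have "\<dots> = d *\<^sub>R mat 1"
    using d by (simp add: psd_sqrt_scalar)
  finally have D: "D_mat \<sigma> (r *\<^sub>R mat 1 :: real^'n^'n) (r *\<^sub>R mat 1) = d *\<^sub>R mat 1" .
  have "det (d *\<^sub>R mat 1 + \<sigma>\<^sup>2 *\<^sub>R mat 1 :: real^'n^'n) = (d + \<sigma>\<^sup>2) ^ CARD('n)"
    by (simp add: scaleR_add_left [symmetric] det_scaleR)
  moreover have "0 < d + \<sigma>\<^sup>2" using d by (simp add: add_pos_nonneg)
  ultimately show ?thesis
    unfolding entropic_bures_def D
    by (simp add: trace_inner inner_mat_1 ln_realpow algebra_simps)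
qed

lemma entropic_bures_not_jointly_convex:
  assumes \<sigma>: "0 < \<sigma>"
  shows "\<not> convex_on ((psd_matrices :: (real^'n^'n) set) \<times> psd_matrices) (\<lambda>(A, B). entropic_bures \<sigma> A B)"
proof
  assume cvx: "convex_on ((psd_matrices :: (real^'n^'n) set) \<times> psd_matrices) (\<lambda>(A, B). entropic_bures \<sigma> A B)"
  define t where "t = \<sigma>\<^sup>2"
  have t: "0 < t" using \<sigma> by (simp add: t_def)
  \<comment> \<open>The points 0, R/2 and R on the diagonal are compared. This R makes the roots of
    4 r^2 + t^2 rational multiples of t: they are t, (13/8) t and (11/4) t.\<close>
  define R where "R = sqrt 105 / 8 * t"
  have R: "0 \<le> R" using t by (simp add: R_def)
  have R2: "R\<^sup>2 = 105 / 64 * t\<^sup>2" by (simp add: R_def power_mult_distrib power_divide)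
  define f where "f r = entropic_bures \<sigma> (r *\<^sub>R mat 1 :: real^'n^'n) (r *\<^sub>R mat 1)" for r
  define k where "k = t * (1 - ln (2 * t))"
  have f: "f r = real CARD('n) * (2 * r - d + k + t * ln (d + t))"
    if "0 \<le> r" "0 < d" "4 * r\<^sup>2 + t\<^sup>2 = d\<^sup>2" for r d
    unfolding f_def k_def t_def
    by (rule entropic_bures_scalar [OF \<sigma>]) (use that in \<open>simp_all add: t_def\<close>)
  have f0: "f 0 = real CARD('n) * (- t + k + t * ln (2 * t))"
    using f [of 0 t] t by simp
  have f2: "f R = real CARD('n) * (2 * R - 11 / 4 * t + k + t * ln (15 / 4 * t))"
  proof -
    have "11 / 4 * t + t = 15 / 4 * t" by simp
    moreover have "4 * R\<^sup>2 + t\<^sup>2 = (11 / 4 * t)\<^sup>2"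
      by (simp add: R2) (simp add: power2_eq_square)
    ultimately show ?thesis using f [of R "11 / 4 * t"] R t by simp
  qed
  have f1: "f (R / 2) = real CARD('n) * (R - 13 / 8 * t + k + t * ln (21 / 8 * t))"
  proof -
    have "13 / 8 * t + t = 21 / 8 * t" by simp
    moreover have "4 * (R / 2)\<^sup>2 + t\<^sup>2 = (13 / 8 * t)\<^sup>2"
      by (simp add: R2 power_divide power_mult_distrib)
    ultimately show ?thesis using f [of "R / 2" "13 / 8 * t"] R t by simp
  qed
  have psd: "r *\<^sub>R mat 1 \<in> (psd_matrices :: (real^'n^'n) set)" if "0 \<le> r" for r
    using that by (intro psd_scaleR psd_mat_1)
  have "f (R / 2) \<le> 1 / 2 * f 0 + 1 / 2 * f R"
    using convex_onD [OF cvx, of "1/2" "(0 *\<^sub>R mat 1, 0 *\<^sub>R mat 1)" "(R *\<^sub>R mat 1, R *\<^sub>R mat 1)"] psd [OF R] psd [of 0]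
    by (simp add: f_def)
  then have "real CARD('n) * (2 * (R - 13 / 8 * t + k + t * ln (21 / 8 * t)))
      \<le> real CARD('n) * ((- t + k + t * ln (2 * t)) + (2 * R - 11 / 4 * t + k + t * ln (15 / 4 * t)))"
    unfolding f0 f1 f2 by (simp add: algebra_simps)
  then have "2 * (R - 13 / 8 * t + k + t * ln (21 / 8 * t))
      \<le> (- t + k + t * ln (2 * t)) + (2 * R - 11 / 4 * t + k + t * ln (15 / 4 * t))"
    by (simp only: mult_le_cancel_left_pos zero_less_card_finite of_nat_0_less_iff)
  then have "t * (1 / 2) \<le> t * (ln (2 * t) + ln (15 / 4 * t) - 2 * ln (21 / 8 * t))"
    by (simp add: algebra_simps)
  then have "1 / 2 \<le> ln (2 * t) + ln (15 / 4 * t) - 2 * ln (21 / 8 * t)"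
    using t by (simp only: mult_le_cancel_left_pos)
  also have "\<dots> = ln 2 + ln (15 / 4) - 2 * ln (21 / 8)"
    using t ln_mult [of 2 t] ln_mult [of "15/4" t] ln_mult [of "21/8" t] by simp
  also have "\<dots> = ln (480 / 441 :: real)"
  proof -
    have "ln (480 / 441 :: real) = ln ((2 * (15 / 4)) / ((21 / 8) * (21 / 8)))" by simp
    also have "\<dots> = ln 2 + ln (15 / 4) - (ln (21 / 8) + ln (21 / 8))"
      by (subst ln_div) (simp_all only: ln_mult, simp_all)
    finally show ?thesis by simp
  qed
  also have "\<dots> \<le> 480 / 441 - 1" by (rule ln_le_minus_one) simp
  finally show False by simp
qed

section \<open>The minimizer in one argument\<close>

lemma transport_diag:
  fixes P :: "real^'n^'n"
  assumes P: "orthogonal_matrix P" and t: "0 < t" and a: "\<And>i. 0 \<le> a $ i" and b: "\<And>i. 0 \<le> b $ i"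
  shows "transport t (P ** diag_matrix a ** transpose P) (P ** diag_matrix b ** transpose P)
    = P ** diag_matrix (\<chi> i. b $ i / (sqrt (a $ i * b $ i + t\<^sup>2 / 4) + t / 2)) ** transpose P"
proof -
  define q where "q = (\<chi> i. sqrt (a $ i * b $ i + t\<^sup>2 / 4) + t / 2)"
  have q: "0 < q $ i" for i
    using a [of i] b [of i] t by (simp add: q_def add_nonneg_pos)
  have "matrix_inv (P ** diag_matrix q ** transpose P) = P ** diag_matrix (\<chi> i. 1 / q $ i) ** transpose P"
  proof (rule matrix_inv_unique)
    have "(\<chi> i. q $ i * (1 / q $ i)) = (\<chi> i. 1)" using q by (simp add: vec_eq_iff less_imp_neq [symmetric])
    then show "P ** diag_matrix q ** transpose P ** (P ** diag_matrix (\<chi> i. 1 / q $ i) ** transpose P) = mat 1"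
      by (simp add: orth_conj_mult [OF P] diag_matrix_mult flip: mat_1_diag)
        (simp add: orth_conj_1 [OF P, simplified])
  qed
  moreover have "shifted_root t (P ** diag_matrix (\<chi> i. a $ i * b $ i) ** transpose P) + (t / 2) *\<^sub>R mat 1
      = P ** diag_matrix q ** transpose P"
  proof -
    have "(\<chi> i. sqrt (a $ i * b $ i + t\<^sup>2 / 4)) + (\<chi> i. t / 2) = q"
      by (simp add: vec_eq_iff q_def)
    moreover have "shifted_root t (P ** diag_matrix (\<chi> i. a $ i * b $ i) ** transpose P)
        = P ** diag_matrix (\<chi> i. sqrt (a $ i * b $ i + t\<^sup>2 / 4)) ** transpose P"
      using a b by (simp add: shifted_root_diag [OF P])
    ultimately show ?thesis
      by (simp only: scaleR_1_orth_conj [OF P] orth_conj_add diag_matrix_add)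
  qed
  moreover have "psd_sqrt (P ** diag_matrix b ** transpose P) = P ** diag_matrix (\<chi> i. sqrt (b $ i)) ** transpose P"
    by (rule psd_sqrt_diag [OF P b])
  moreover have "(\<chi> i. sqrt (b $ i) * a $ i * sqrt (b $ i)) = (\<chi> i. a $ i * b $ i)"
    using b by (simp add: vec_eq_iff mult.assoc mult.left_commute)
  moreover have "(\<chi> i. sqrt (b $ i) / q $ i * sqrt (b $ i)) = (\<chi> i. b $ i / q $ i)"
    using b by (simp add: vec_eq_iff)
  ultimately show ?thesis
    unfolding transport_def resolvent_def
    by (simp add: orth_conj_mult [OF P] diag_matrix_mult q_def)
qed

lemma entropic_bures_minimizer:
  fixes P :: "real^'n^'n"
  assumes \<sigma>: "0 < \<sigma>" and B: "B \<in> psd_matrices" and P: "orthogonal_matrix P"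
    and Bs: "B = P ** diag_matrix s ** transpose P"
  shows "is_arg_min (\<lambda>A. entropic_bures \<sigma> A B) (\<lambda>A. A \<in> psd_matrices)
    (P ** diag_matrix (\<chi> i. max (s $ i - \<sigma>\<^sup>2) 0) ** transpose P)"
proof -
  define t where "t = \<sigma>\<^sup>2"
  have t: "0 < t" using \<sigma> by (simp add: t_def)
  define a where "a = (\<chi> i. max (s $ i - t) 0)"
  define A0 where "A0 = P ** diag_matrix a ** transpose P"
  \<comment> \<open>The eigenvalues of the slope at A0, in the eigenbasis P.\<close>
  define g where "g = (\<chi> i. 1 - s $ i / (sqrt (a $ i * s $ i + t\<^sup>2 / 4) + t / 2))"
  have a: "0 \<le> a $ i" for i by (simp add: a_def)
  have s: "0 \<le> s $ i" for i using psd_conj_diag [OF P] B Bs by blast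
  have A0: "A0 \<in> psd_matrices" unfolding A0_def psd_conj_diag [OF P] using a by blast
  have g: "0 \<le> g $ i \<and> a $ i * g $ i = 0" for i
  proof (cases "t \<le> s $ i")
    case True
    then have "a $ i * s $ i + t\<^sup>2 / 4 = (s $ i - t / 2)\<^sup>2"
      by (simp add: a_def power2_eq_square algebra_simps)
    then have "sqrt (a $ i * s $ i + t\<^sup>2 / 4) = s $ i - t / 2"
      using True t by simp
    then show ?thesis using True t by (simp add: g_def)
  next
    case False
    have "sqrt (t\<^sup>2 / 4) = t / 2" using t by (simp add: real_sqrt_divide)
    with False show ?thesis using t by (simp add: g_def a_def)
  qed
  have grad: "mat 1 - transport t A0 B = P ** diag_matrix g ** transpose P"
  proof -
    have "mat 1 - transport t A0 B
        = P ** (mat 1 - diag_matrix (\<chi> i. s $ i / (sqrt (a $ i * s $ i + t\<^sup>2 / 4) + t / 2))) ** transpose P"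
      using orth_conj_1 [OF P]
      by (simp add: A0_def Bs transport_diag [OF P t a s] matrix_diff_ldistrib matrix_diff_rdistrib)
    moreover have "(\<chi> i. 1) - (\<chi> i. s $ i / (sqrt (a $ i * s $ i + t\<^sup>2 / 4) + t / 2)) = g"
      by (simp add: g_def vec_eq_iff)
    ultimately show ?thesis
      by (simp only: mat_1_diag diag_matrix_diff)
  qed
  have gpsd: "P ** diag_matrix g ** transpose P \<in> psd_matrices"
    using g by (simp add: psd_conj_diag [OF P])
  have orth0: "(P ** diag_matrix g ** transpose P) \<bullet> A0 = 0"
  proof -
    have "(P ** diag_matrix g ** transpose P) \<bullet> A0
        = mat 1 \<bullet> ((P ** diag_matrix g ** transpose P) ** A0)"
      using inner_mult_left [of "P ** diag_matrix g ** transpose P" "mat 1" A0] sym_transpose [OF psd_sym [OF gpsd]]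
      by simp
    also have "\<dots> = (\<Sum>i\<in>UNIV. g $ i * a $ i)"
      by (simp add: A0_def orth_conj_mult [OF P] trace_orth_conj [OF P] diag_matrix_mult trace_diag)
    also have "\<dots> = 0" using g by (intro sum.neutral) (simp add: mult.commute)
    finally show ?thesis .
  qed
  have "entropic_bures \<sigma> A0 B \<le> entropic_bures \<sigma> X B" if X: "X \<in> psd_matrices" for X
  proof -
    have "0 \<le> (mat 1 - transport t A0 B) \<bullet> (X - A0)"
      unfolding grad inner_diff_right orth0 using psd_inner_nonneg [OF gpsd X] by simp
    then show ?thesis
      using entropic_bures_tangent [OF \<sigma> A0 X B] by (simp add: t_def)
  qed
  then show ?thesis
    using A0 by (auto simp: is_arg_min_def A0_def a_def t_def not_less)
qed

section \<open>The dual problem\<close>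

lemma block_mat_quadratic:
  fixes F G :: "real^'n^'n"
  shows "z \<bullet> (block_mat F G *v z)
    = (\<chi> i. z $ Inl i) \<bullet> (F *v (\<chi> i. z $ Inl i)) - 2 * ((\<chi> i. z $ Inl i) \<bullet> (\<chi> i. z $ Inr i))
      + (\<chi> i. z $ Inr i) \<bullet> (G *v (\<chi> i. z $ Inr i))"
proof -
  have sum: "(\<Sum>i\<in>UNIV. f i) = (\<Sum>i\<in>UNIV. f (Inl i)) + (\<Sum>i\<in>UNIV. f (Inr i))"
    for f :: "'n + 'n \<Rightarrow> real"
    by (simp add: UNIV_Plus_UNIV [symmetric] sum.Plus del: UNIV_Plus_UNIV)
  show ?thesis
    by (simp add: inner_vec_def matrix_vector_mult_def sum block_mat_def mat_def
        if_distrib [of "\<lambda>x. x * _"] if_distrib [of uminus] sum.distrib distrib_left sum_negf cong: if_cong)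
      (simp add: algebra_simps sum.distrib)
qed

lemma block_mat_sym:
  "F \<in> sym_matrices \<Longrightarrow> G \<in> sym_matrices \<Longrightarrow> block_mat F G \<in> sym_matrices"
  by (auto simp: sym_matrices_def transpose_def vec_eq_iff block_mat_def mat_def split: sum.split)

text \<open>The Schur complement criterion, by completing the square in the second block of variables.\<close>

lemma block_mat_pd_iff:
  fixes F G :: "real^'n^'n"
  assumes F: "F \<in> pd_matrices" and G: "G \<in> pd_matrices"
  shows "block_mat F G \<in> pd_matrices \<longleftrightarrow> F - matrix_inv G \<in> pd_matrices"
proof -
  define W where "W = matrix_inv G"
  have GW: "G ** W = mat 1" "W ** G = mat 1" using pd_inv [OF G] by (auto simp: W_def)
  have W: "W \<in> pd_matrices" using pd_matrix_inv [OF G] by (simp add: W_def)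
  have quad: "x \<bullet> (F *v x) - 2 * (x \<bullet> y) + y \<bullet> (G *v y)
      = x \<bullet> ((F - W) *v x) + (y - W *v x) \<bullet> (G *v (y - W *v x))" for x y
  proof -
    have 1: "G *v (W *v x) = x" by (simp add: matrix_vector_mul_assoc GW)
    have "(W *v x) \<bullet> (G *v y) = x \<bullet> y"
      using sym_inner_mult [OF pd_sym [OF G], of "W *v x" y] 1 by simp
    then show ?thesis
      by (simp add: matrix_vector_mult_diff_rdistrib matrix_vector_mult_diff_distrib 1
          inner_diff_left inner_diff_right inner_commute)
  qed
  show ?thesis unfolding W_def [symmetric]
  proof
    assume blk: "block_mat F G \<in> pd_matrices"
    show "F - W \<in> pd_matrices"
      unfolding pd_matrices_def
    proof (intro CollectI conjI allI impI)
      show "F - W \<in> sym_matrices" by (intro sym_diff pd_sym F W)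
      fix x :: "real^'n" assume x: "x \<noteq> 0"
      define z where "z = (\<chi> k. case k of Inl i \<Rightarrow> x $ i | Inr i \<Rightarrow> (W *v x) $ i)"
      have zl: "(\<chi> i. z $ Inl i) = x" and zr: "(\<chi> i. z $ Inr i) = W *v x"
        by (simp_all add: z_def vec_eq_iff)
      have "z \<noteq> 0"
      proof
        assume "z = 0"
        then have "x $ i = 0" for i using zl by (auto simp: vec_eq_iff)
        then show False using x by (simp add: vec_eq_iff)
      qed
      then have "0 < z \<bullet> (block_mat F G *v z)" using blk by (simp add: pd_matrices_def)
      then show "0 < x \<bullet> ((F - W) *v x)"
        unfolding block_mat_quadratic zl zr quad by simp
    qed
  next
    assume FW: "F - W \<in> pd_matrices"
    show "block_mat F G \<in> pd_matrices"
      unfolding pd_matrices_def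
    proof (intro CollectI conjI allI impI)
      show "block_mat F G \<in> sym_matrices" by (intro block_mat_sym pd_sym F G)
      fix z :: "real^('n + 'n)" assume z: "z \<noteq> 0"
      define x where "x = (\<chi> i. z $ Inl i)"
      define y where "y = (\<chi> i. z $ Inr i)"
      have "0 < x \<bullet> ((F - W) *v x) + (y - W *v x) \<bullet> (G *v (y - W *v x))"
      proof (cases "x = 0")
        case False
        then show ?thesis
          using FW psd_quadratic [OF pd_psd [OF G]] by (simp add: pd_matrices_def add_pos_nonneg)
      next
        case True
        have "y \<noteq> 0"
        proof
          assume "y = 0"
          then have "z $ k = 0" for k using True by (cases k) (auto simp: x_def y_def vec_eq_iff)
          then show False using z by (simp add: vec_eq_iff)
        qed
        then show ?thesis using True G by (simp add: pd_matrices_def)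
      qed
      then show "0 < z \<bullet> (block_mat F G *v z)"
        unfolding block_mat_quadratic x_def [symmetric] y_def [symmetric] quad .
    qed
  qed
qed

lemma log_det_term_eq:
  fixes F G :: "real^'n^'n"
  assumes \<sigma>: "0 < \<sigma>" and F: "F \<in> pd_matrices" and G: "G \<in> pd_matrices"
    and E: "F - matrix_inv G \<in> pd_matrices"
  shows "log_det_term \<sigma> F G
    = ereal (ln (det G) + ln (det (F - matrix_inv G)) - real CARD('n) * ln (\<sigma>^4))"
proof -
  have "F ** G - mat 1 = (F - matrix_inv G) ** G" by (simp add: mat_ring pd_inv [OF G])
  then have "det ((1 / \<sigma>^4) *\<^sub>R (F ** G - mat 1)) = (1 / \<sigma>^4) ^ CARD('n) * (det (F - matrix_inv G) * det G)"
    by (simp add: det_scaleR det_mul)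
  moreover have "0 < det G" "0 < det (F - matrix_inv G)" using pd_det_pos G E by blast+
  ultimately have "ln (det ((1 / \<sigma>^4) *\<^sub>R (F ** G - mat 1)))
      = ln (det G) + ln (det (F - matrix_inv G)) - real CARD('n) * ln (\<sigma>^4)"
    using \<sigma> by (simp add: ln_mult ln_realpow ln_div power_divide)
  then show ?thesis
    using E block_mat_pd_iff [OF F G] by (simp add: log_det_term_def)
qed

text \<open>The maximizer is \<open>G\<^sub>0 = W\<^sup>-\<^sup>1\<close>, \<open>F\<^sub>0 = \<sigma>\<^sup>2 A\<^sup>-\<^sup>1 + W\<close> with \<open>W = \<Phi>(A,B)\<close>. The comparison with another feasible pair is
  made in the variables \<open>G\<close> and \<open>E = F - G\<^sup>-\<^sup>1\<close>, in which the determinant factorizes.\<close>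

lemma dual_problem:
  fixes A B :: "real^'n^'n"
  assumes \<sigma>: "0 < \<sigma>" and A: "A \<in> pd_matrices" and B: "B \<in> pd_matrices"
  shows "\<exists>F G. is_dual_optimal \<sigma> A B (F, G) \<and> (\<forall>p. is_dual_optimal \<sigma> A B p \<longrightarrow> p = (F, G)) \<and>
    F = \<sigma>\<^sup>2 *\<^sub>R matrix_inv A + matrix_inv G \<and> G = \<sigma>\<^sup>2 *\<^sub>R matrix_inv B + matrix_inv F"
proof -
  define t where "t = \<sigma>\<^sup>2"
  have t: "0 < t" using \<sigma> by (simp add: t_def)
  define b where "b = psd_sqrt B"
  define M where "M = b ** A ** b"
  define K where "K = resolvent t M"
  define W where "W = transport t A B"
  note Ap = pd_psd [OF A] and Bp = pd_psd [OF B]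
  have bs: "b \<in> sym_matrices" "b ** b = B" using psd_sqrt [OF Bp] psd_sym by (auto simp: b_def)
  have M: "M \<in> psd_matrices" unfolding M_def by (intro psd_conj_sym Ap bs)
  have Wdef: "W = b ** K ** b" by (simp add: W_def transport_def b_def K_def M_def)
  have W: "W \<in> pd_matrices"
    unfolding Wdef K_def
    by (rule pd_conj [OF resolvent_pd [OF M t] bs(1)]) (unfold b_def, rule psd_sqrt_pd_inv [OF B])
  \<comment> \<open>The Riccati equation that expresses stationarity in G.\<close>
  have stat: "W ** A ** W + t *\<^sub>R W = B"
  proof -
    have "W ** A ** W = b ** (K ** M ** K) ** b" by (simp add: Wdef M_def matrix_mul_assoc)
    also have "\<dots> = B - t *\<^sub>R W"
      unfolding K_def resolvent_conj [OF M t] by (simp add: mat_ring bs Wdef K_def)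
    finally show ?thesis by simp
  qed
  define G0 where "G0 = matrix_inv W"
  define E0 where "E0 = t *\<^sub>R matrix_inv A"
  define F0 where "F0 = E0 + W"
  have G0: "G0 \<in> pd_matrices" unfolding G0_def by (rule pd_matrix_inv [OF W])
  have WG: "W ** G0 = mat 1" "G0 ** W = mat 1" using pd_inv [OF W] by (auto simp: G0_def)
  have G0i: "matrix_inv G0 = W" by (rule matrix_inv_unique [OF WG(2)])
  have E0: "E0 \<in> pd_matrices" unfolding E0_def by (intro pd_scaleR pd_matrix_inv A t)
  have E0i: "matrix_inv E0 = (1 / t) *\<^sub>R A"
    by (rule matrix_inv_unique) (use t in \<open>simp add: E0_def mat_ring pd_inv [OF A]\<close>)
  have F0: "F0 \<in> pd_matrices" unfolding F0_def by (rule pd_add_psd [OF E0 pd_psd [OF W]])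
  have F0E: "F0 - matrix_inv G0 = E0" by (simp add: F0_def G0i)
  have fixF: "F0 = t *\<^sub>R matrix_inv A + matrix_inv G0" by (simp add: F0_def E0_def G0i)
  have fixG: "G0 = t *\<^sub>R matrix_inv B + matrix_inv F0"
  proof -
    have "B = W ** A ** F0"
      using stat by (simp add: F0_def E0_def mat_ring)
        (simp add: pd_inv [OF A] add.commute flip: matrix_mul_assoc)
    then have "W ** A ** (F0 ** matrix_inv B) = B ** matrix_inv B" by (simp add: matrix_mul_assoc)
    then have "matrix_inv A ** G0 ** (W ** A ** (F0 ** matrix_inv B)) = matrix_inv A ** G0"
      by (simp add: pd_inv [OF B])
    moreover have "matrix_inv A ** G0 ** (W ** A ** (F0 ** matrix_inv B))
        = matrix_inv A ** (G0 ** W) ** A ** F0 ** matrix_inv B" by (simp only: matrix_mul_assoc)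
    ultimately have F0B: "F0 ** matrix_inv B = matrix_inv A ** G0" by (simp add: WG pd_inv [OF A])
    have "F0 ** (G0 - t *\<^sub>R matrix_inv B) = F0 ** G0 - t *\<^sub>R (matrix_inv A ** G0)"
      by (simp add: mat_ring F0B)
    also have "\<dots> = mat 1" by (simp add: F0_def E0_def mat_ring WG)
    finally have "matrix_inv F0 = G0 - t *\<^sub>R matrix_inv B" by (rule matrix_inv_unique)
    then show ?thesis by simp
  qed
  define c where "c = mat 1 \<bullet> A + mat 1 \<bullet> B - t * (real CARD('n) * ln (\<sigma>^4))
    + (\<sigma>\<^sup>2 * ln (det (A ** B)) + 2 * real CARD('n) * \<sigma>\<^sup>2)"
  define J where "J F G = c - F \<bullet> A - G \<bullet> B + t * (ln (det G) + ln (det (F - matrix_inv G)))" for F G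
  have obj: "dual_objective \<sigma> A B F G = (if F - matrix_inv G \<in> pd_matrices then ereal (J F G) else - \<infinity>)"
    if "F \<in> pd_matrices" "G \<in> pd_matrices" for F G
  proof (cases "F - matrix_inv G \<in> pd_matrices")
    case True
    then show ?thesis
      by (simp add: dual_objective_def log_det_term_eq [OF \<sigma> that True] J_def c_def t_def inner_diff_left algebra_simps)
  next
    case False
    then show ?thesis
      using \<sigma> block_mat_pd_iff [OF that] by (simp add: dual_objective_def log_det_term_def)
  qed
  have main: "J F G < J F0 G0"
    if F: "F \<in> pd_matrices" and G: "G \<in> pd_matrices" and E: "F - matrix_inv G \<in> pd_matrices"
      and ne: "(F, G) \<noteq> (F0, G0)" for F G
  proof -
    define V where "V = matrix_inv G"
    define E where "E = F - V"
    have V: "V \<in> pd_matrices" unfolding V_def by (rule pd_matrix_inv [OF G])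
    have Epd: "E \<in> pd_matrices" using \<open>F - matrix_inv G \<in> pd_matrices\<close> by (simp add: E_def V_def)
    have VG: "V ** G = mat 1" "G ** V = mat 1" using pd_inv [OF G] by (auto simp: V_def)
    have g: "ln (det G) \<le> ln (det G0) + W \<bullet> (G - G0)"
      and g': "G \<noteq> G0 \<Longrightarrow> ln (det G) < ln (det G0) + W \<bullet> (G - G0)"
      using ln_det_le [OF G G0] by (auto simp: G0i)
    have e: "ln (det E) \<le> ln (det E0) + (1 / t) * (A \<bullet> (E - E0))"
      and e': "E \<noteq> E0 \<Longrightarrow> ln (det E) < ln (det E0) + (1 / t) * (A \<bullet> (E - E0))"
      using ln_det_le [OF Epd E0] by (auto simp: E0i)
    have "G \<noteq> G0 \<or> E \<noteq> E0"
      using ne by (auto simp: E_def V_def F0_def G0i)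
    then have "ln (det G) + ln (det E) < ln (det G0) + W \<bullet> (G - G0) + (ln (det E0) + (1 / t) * (A \<bullet> (E - E0)))"
      using g g' e e' by (auto intro: add_less_le_mono add_le_less_mono)
    then have "t * (ln (det G) + ln (det E))
        < t * (ln (det G0) + W \<bullet> (G - G0) + (ln (det E0) + (1 / t) * (A \<bullet> (E - E0))))"
      using t by (intro mult_strict_left_mono) auto
    then have ln: "t * (ln (det G) + ln (det E))
        < t * (ln (det G0) + ln (det E0)) + t * (W \<bullet> (G - G0)) + A \<bullet> (E - E0)"
      using t by (simp add: algebra_simps)
    \<comment> \<open>Operator convexity of the inverse, tested against A.\<close>
    have inv: "0 \<le> (V - W) \<bullet> A + (W ** A ** W) \<bullet> (G - G0)"
    proof -
      have "(V - W) ** G ** (V - W) = V - 2 *\<^sub>R W + W ** G ** W"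
      proof -
        have "(V - W) ** G ** (V - W) = (V ** G) ** V - (V ** G) ** W - W ** (G ** V) + W ** G ** W"
          by (simp add: mat_ring)
        then show ?thesis by (simp add: VG scaleR_2)
      qed
      moreover have "W ** (G - G0) ** W = W ** G ** W - W"
        by (simp add: mat_ring WG)
      ultimately have "(V - W) ** G ** (V - W) = (V - W) + W ** (G - G0) ** W"
        by (simp add: scaleR_2)
      moreover have "0 \<le> ((V - W) ** G ** (V - W)) \<bullet> A"
        by (intro psd_inner_nonneg psd_conj_sym pd_psd [OF G] sym_diff pd_sym V W Ap)
      moreover have "(W ** (G - G0) ** W) \<bullet> A = (W ** A ** W) \<bullet> (G - G0)"
      proof -
        have "(W ** (G - G0) ** W) \<bullet> A = (G - G0) \<bullet> (W ** (A ** W))"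
          by (simp only: inner_sym_right [OF pd_sym [OF W]] inner_sym_left [OF pd_sym [OF W]])
        then show ?thesis by (simp only: inner_commute matrix_mul_assoc)
      qed
      ultimately show ?thesis by (simp add: inner_add_left)
    qed
    have "B \<bullet> (G - G0) = (W ** A ** W) \<bullet> (G - G0) + t * (W \<bullet> (G - G0))"
      unfolding stat [symmetric] by (simp add: inner_add_left)
    moreover have "J F G = c - (E + V) \<bullet> A - G \<bullet> B + t * (ln (det G) + ln (det E))"
      by (simp add: J_def E_def V_def)
    moreover have "J F0 G0 = c - (E0 + W) \<bullet> A - G0 \<bullet> B + t * (ln (det G0) + ln (det E0))"
      unfolding J_def F0E by (simp add: F0_def)
    ultimately show ?thesis using ln inv
      by (simp add: inner_add_left inner_add_right inner_diff_left inner_diff_right inner_commute)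
  qed
  let ?f = "\<lambda>(F, G). dual_objective \<sigma> A B F G"
  have val0: "?f (F0, G0) = ereal (J F0 G0)" using obj [OF F0 G0] F0E E0 by simp
  have best: "?f p < ?f (F0, G0)" if "p \<in> pd_matrices \<times> pd_matrices" "p \<noteq> (F0, G0)" for p
  proof -
    obtain F G where p: "p = (F, G)" by (cases p)
    then have FG: "F \<in> pd_matrices" "G \<in> pd_matrices" using that by auto
    show ?thesis
      using main [OF FG] that(2) val0 obj [OF FG] by (auto simp: p)
  qed
  have opt: "is_dual_optimal \<sigma> A B (F0, G0)"
  proof -
    have "\<not> ?f (F0, G0) < ?f p" if "p \<in> pd_matrices \<times> pd_matrices" for p
    proof (cases "p = (F0, G0)")
      case True
      then show ?thesis by (simp only: less_irrefl not_False_eq_True)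
    next
      case False
      from best [OF that this] show ?thesis by (rule less_not_sym)
    qed
    then show ?thesis
      unfolding is_dual_optimal_def is_arg_max_def
      by (intro conjI notI SigmaI F0 G0) (elim exE conjE, simp only: not_True_eq_False)
  qed
  have uniq: "p = (F0, G0)" if "is_dual_optimal \<sigma> A B p" for p
  proof (rule ccontr)
    assume ne: "p \<noteq> (F0, G0)"
    note opt_p = that [unfolded is_dual_optimal_def is_arg_max_def]
    have "?f p < ?f (F0, G0)" by (rule best [OF conjunct1 [OF opt_p] ne])
    then have "\<exists>y. y \<in> pd_matrices \<times> pd_matrices \<and> ?f p < ?f y"
      by (intro exI [of _ "(F0, G0)"] conjI SigmaI F0 G0)
    with conjunct2 [OF opt_p] show False by (rule notE)
  qed
  show ?thesis
  proof (rule exI [of _ F0], rule exI [of _ G0], intro conjI allI impI)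
    show "is_dual_optimal \<sigma> A B (F0, G0)" by (rule opt)
    show "p = (F0, G0)" if "is_dual_optimal \<sigma> A B p" for p using that by (rule uniq)
    show "F0 = \<sigma>\<^sup>2 *\<^sub>R matrix_inv A + matrix_inv G0" using fixF unfolding t_def .
    show "G0 = \<sigma>\<^sup>2 *\<^sub>R matrix_inv B + matrix_inv F0" using fixG unfolding t_def .
  qed
qed

theorem proposition6:
  fixes \<sigma> :: real
  assumes "\<sigma> > 0"
  shows
    "(\<forall>A \<in> (pd_matrices :: (real^'n^'n) set). \<forall>B \<in> pd_matrices.
        (\<exists>!p. is_dual_optimal \<sigma> A B p) \<and>
        (\<forall>F G. is_dual_optimal \<sigma> A B (F, G) \<longrightarrow>
           F = \<sigma>\<^sup>2 *\<^sub>R matrix_inv A + matrix_inv G \<and>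
           G = \<sigma>\<^sup>2 *\<^sub>R matrix_inv B + matrix_inv F))
     \<and>
     (\<forall>A \<in> (psd_matrices :: (real^'n^'n) set). \<forall>B \<in> psd_matrices.
        has_gradient_in (sym_matrices \<times> sym_matrices) (\<lambda>(X, Y). entropic_bures \<sigma> X Y)
          (- (\<sigma>\<^sup>2 *\<^sub>R U_mat \<sigma> A B, \<sigma>\<^sup>2 *\<^sub>R V_mat \<sigma> A B)) (A, B) (psd_matrices \<times> psd_matrices) \<and>
        has_gradient_in sym_matrices (\<lambda>X. entropic_bures \<sigma> X B)
          (mat 1 - psd_sqrt B **
             matrix_inv (psd_sqrt (psd_sqrt B ** A ** psd_sqrt B + (\<sigma>^4 / 4) *\<^sub>R mat 1)
                         + (\<sigma>\<^sup>2 / 2) *\<^sub>R mat 1) **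
             psd_sqrt B) A psd_matrices)
     \<and>
     ((\<forall>B \<in> (psd_matrices :: (real^'n^'n) set). convex_on psd_matrices (\<lambda>A. entropic_bures \<sigma> A B)) \<and>
      (\<forall>A \<in> (psd_matrices :: (real^'n^'n) set). convex_on psd_matrices (\<lambda>B. entropic_bures \<sigma> A B)) \<and>
      \<not> convex_on ((psd_matrices :: (real^'n^'n) set) \<times> psd_matrices) (\<lambda>(A, B). entropic_bures \<sigma> A B))
     \<and>
     (\<forall>B \<in> (psd_matrices :: (real^'n^'n) set). \<forall>P s.
        orthogonal_matrix P \<and> B = P ** diag_matrix s ** transpose P \<longrightarrow>
        is_arg_min (\<lambda>A. entropic_bures \<sigma> A B) (\<lambda>A. A \<in> psd_matrices)
          (P ** diag_matrix (\<chi> i. max (s $ i - \<sigma>\<^sup>2) 0) ** transpose P))"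
proof (intro conjI ballI)
  fix A B :: "real^'n^'n" assume A: "A \<in> pd_matrices" and B: "B \<in> pd_matrices"
  obtain F G where opt: "is_dual_optimal \<sigma> A B (F, G)"
    and uniq: "\<forall>p. is_dual_optimal \<sigma> A B p \<longrightarrow> p = (F, G)"
    and eqs: "F = \<sigma>\<^sup>2 *\<^sub>R matrix_inv A + matrix_inv G" "G = \<sigma>\<^sup>2 *\<^sub>R matrix_inv B + matrix_inv F"
    using dual_problem [OF assms A B] by blast
  show "\<exists>!p. is_dual_optimal \<sigma> A B p"
    using opt uniq by blast
  show "\<forall>F G. is_dual_optimal \<sigma> A B (F, G) \<longrightarrow> F = \<sigma>\<^sup>2 *\<^sub>R matrix_inv A + matrix_inv G \<and>
      G = \<sigma>\<^sup>2 *\<^sub>R matrix_inv B + matrix_inv F"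
    using uniq eqs by blast
next
  fix A B :: "real^'n^'n" assume A: "A \<in> psd_matrices" and B: "B \<in> psd_matrices"
  have t: "0 < \<sigma>\<^sup>2" using assms by simp
  have sym: "mat 1 - transport (\<sigma>\<^sup>2) A B \<in> sym_matrices" "mat 1 - transport (\<sigma>\<^sup>2) B A \<in> sym_matrices"
    by (intro sym_diff sym_mat_1 psd_sym transport_psd t A B)+
  have "- (\<sigma>\<^sup>2 *\<^sub>R U_mat \<sigma> A B, \<sigma>\<^sup>2 *\<^sub>R V_mat \<sigma> A B) = (mat 1 - transport (\<sigma>\<^sup>2) A B, mat 1 - transport (\<sigma>\<^sup>2) B A)"
    using UV_mat_eq [OF assms A B] by simp
  then show "has_gradient_in (sym_matrices \<times> sym_matrices) (\<lambda>(X, Y). entropic_bures \<sigma> X Y)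
      (- (\<sigma>\<^sup>2 *\<^sub>R U_mat \<sigma> A B, \<sigma>\<^sup>2 *\<^sub>R V_mat \<sigma> A B)) (A, B) (psd_matrices \<times> psd_matrices)"
    using entropic_bures_gradient [OF assms A B] sym by (simp add: has_gradient_in_def)
  have "\<sigma>^4 / 4 = (\<sigma>\<^sup>2)\<^sup>2 / 4" by (simp add: power_mult [symmetric])
  then show "has_gradient_in sym_matrices (\<lambda>X. entropic_bures \<sigma> X B)
      (mat 1 - psd_sqrt B ** matrix_inv (psd_sqrt (psd_sqrt B ** A ** psd_sqrt B + (\<sigma>^4 / 4) *\<^sub>R mat 1)
        + (\<sigma>\<^sup>2 / 2) *\<^sub>R mat 1) ** psd_sqrt B) A psd_matrices"
    using entropic_bures_partial_gradient [OF assms A B] sym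
    by (simp add: has_gradient_in_def transport_def resolvent_def shifted_root_def)
next
  fix B :: "real^'n^'n" assume B: "B \<in> psd_matrices"
  show cvx: "convex_on psd_matrices (\<lambda>A. entropic_bures \<sigma> A B)"
    by (rule convex_on_tangentI [OF convex_psd entropic_bures_tangent [OF assms _ _ B]])
  have "entropic_bures \<sigma> B X + (mat 1 - transport (\<sigma>\<^sup>2) X B) \<bullet> (Y - X) \<le> entropic_bures \<sigma> B Y"
    if "X \<in> psd_matrices" "Y \<in> psd_matrices" for X Y
    using entropic_bures_tangent [OF assms that B] entropic_bures_sym [OF assms B] that by simp
  then show "convex_on psd_matrices (\<lambda>X. entropic_bures \<sigma> B X)"
    by (rule convex_on_tangentI [OF convex_psd])
next
  show "\<not> convex_on ((psd_matrices :: (real^'n^'n) set) \<times> psd_matrices) (\<lambda>(A, B). entropic_bures \<sigma> A B)"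
    by (rule entropic_bures_not_jointly_convex [OF assms])
next
  fix B :: "real^'n^'n" assume "B \<in> psd_matrices"
  then show "\<forall>P s. orthogonal_matrix P \<and> B = P ** diag_matrix s ** transpose P \<longrightarrow>
      is_arg_min (\<lambda>A. entropic_bures \<sigma> A B) (\<lambda>A. A \<in> psd_matrices)
        (P ** diag_matrix (\<chi> i. max (s $ i - \<sigma>\<^sup>2) 0) ** transpose P)"
    using entropic_bures_minimizer [OF assms] by blast
qed

end
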